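(* For every fixed integer $n\ge 3$ there exist constants $c_n,C_n>0$ (depending only on $n$) such that the following holds for every integer $N\ge 1$ and every $a=(a_1,\dots,a_n)\in\Delta_N^{(n)}$ with $a_1\ge a_2\ge\cdots\ge a_n$. Let $g:\Delta_N^{(n)}\to\mathbb R$ satisfy $g(a)\ne 0$ and $$\sum_{i=1}^n g(\beta+e_i)=0\qquad\text{for all }\beta\in\Delta_{N-1}^{(n)}.$$ Then $$\#\left\{\alpha\in\Delta_N^{(n)}:\ |g(\alpha)|\ge \mathrm e^{-C_nN}\,|g(a)|\right\}\ \ge\ c_n\,\Phi_n(a),$$ where $$\Phi_n(a):=\frac{(a_n+1)\prod_{i=1}^{n-2}(a_i+1)}{(N+1)^{h_0}},\qquad h_0=\left\lfloor\frac{n-2}{2}\right\rfloor.$$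
   Context: For integers $N\ge 0$ and $n\ge 1$, $\Delta_N^{(n)}:=\{\alpha=(\alpha_1,\dots,\alpha_n)\in\mathbb Z_{\ge 0}^n:\ \sum_{i=1}^n\alpha_i=N\}$ is the simplex lattice. $e_i$ denotes the $i$th coordinate vector in $\mathbb Z^n$, $\mathrm e$ is Euler's number, and $\#$ denotes cardinality. *)

theory Defs
  imports Complex_Main
begin

(* A vector (v_1, ..., v_n) of nonnegative integers is a function on nat that vanishes outside
   the index set {1..n}; this makes the representation of each vector unique. *)

definition simplex_lattice :: "nat \<Rightarrow> nat \<Rightarrow> (nat \<Rightarrow> nat) set" where
  "simplex_lattice n N = {\<alpha>. (\<forall>i. i \<notin> {1..n} \<longrightarrow> \<alpha> i = 0) \<and> (\<Sum>i=1..n. \<alpha> i) = N}"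

lemma finite_simplex_lattice: "finite (simplex_lattice n N)"
proof (rule finite_subset)
  show "simplex_lattice n N \<subseteq>
      {f. \<forall>i. (i \<in> {1..n} \<longrightarrow> f i \<in> {..N}) \<and> (i \<notin> {1..n} \<longrightarrow> f i = 0)}"
    by (auto simp: simplex_lattice_def intro: member_le_sum)
  show "finite {f :: nat \<Rightarrow> nat. \<forall>i. (i \<in> {1..n} \<longrightarrow> f i \<in> {..N}) \<and> (i \<notin> {1..n} \<longrightarrow> f i = 0)}"
    by (rule finite_set_of_finite_funs) auto
qed

definition coord_vec :: "nat \<Rightarrow> nat \<Rightarrow> nat" where
  "coord_vec i = (\<lambda>j. if j = i then 1 else 0)"

(* N is the coordinate sum of a. The subtractions on nat are exact for n at least 2. *)
definition Phi :: "nat \<Rightarrow> nat \<Rightarrow> (nat \<Rightarrow> nat) \<Rightarrow> real" where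
  "Phi n N a =
     (real (a n) + 1) * (\<Prod>i=1..n-2. (real (a i) + 1)) / (real N + 1) ^ ((n - 2) div 2)"

end

theory Submission
  imports Defs "HOL-Computational_Algebra.Polynomial" "HOL-Library.FuncSet"
begin

text \<open>
  Extend \<open>g\<close> by \<open>0\<close> outside the simplex and let \<open>D\<^sub>i = E\<^sub>i + \<dots> + E\<^sub>n\<close> be the sum of the unit shifts
  in the directions \<open>i, \<dots>, n\<close>. The hypothesis says \<open>E\<^sub>1 = - D\<^sub>2\<close>, so a shift by \<open>a\<close> in direction \<open>1\<close>
  is \<open>D\<^sub>2\<close> to the power \<open>a\<close> up to sign. Since \<open>D\<^sub>i = E\<^sub>i + D\<^sub>i\<^sub>+\<^sub>1\<close>, the powers of \<open>D\<^sub>i\<close> along a line in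
  direction \<open>i\<close> are the binomial transform of those of \<open>D\<^sub>i\<^sub>+\<^sub>1\<close>.

  Let \<open>b\<close> maximize \<open>\<bar>g\<bar>\<close>, penalized by a steeply weighted linear form, over the part of a layer above a
  corner \<open>x\<close>. If the excess of \<open>b\<close> over \<open>x\<close> is at least \<open>m\<close> in a direction \<open>i\<close>, then \<open>g\<close> is tiny below
  \<open>b\<close> in that direction, the transform is a polynomial of low degree up to a tiny error, and
  Lagrange interpolation yields about \<open>m\<close> large values. Descending from \<open>i = n\<close> to \<open>i = 2\<close>, each
  such direction contributes a factor \<open>m\<close> to the number of large values near \<open>b\<close>.

  Among \<open>2 q\<close> directions take for \<open>m\<close> the \<open>q\<close>th smallest excess: \<open>q + 1\<close> directions have excess at least
  \<open>m\<close>, while the points found stay within \<open>O(m)\<close> of \<open>x\<close> in \<open>q\<close> directions and in direction \<open>1\<close>. Varying \<open>x\<close>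
  over a cube of side \<open>T\<close> and selecting disjoint boxes greedily as in Vitali's lemma gives
  about \<open>(T / t)\<^sup>q\<^sup>+\<^sup>1\<close> large values at mutual distance \<open>t\<close>. Repeating this around every point found, for the
  scales \<open>T \<approx> a\<^sub>1, a\<^sub>3, a\<^sub>5, \<dots>\<close> with \<open>q = 0, 1, 2, \<dots>\<close> and each \<open>t\<close> comparable to the next \<open>T\<close>, the
  counts telescope to the product of the \<open>a\<^sub>k + 1\<close> over odd \<open>k\<close>, which dominates \<open>\<Phi>\<^sub>n(a)\<close>.
\<close>

section \<open>Sums of binomial type with many large values\<close>

text \<open>Induction removing the maximum: positivity puts \<open>A\<close> inside
  \<open>{1..Max A}\<close>, so \<open>Max A\<close> is at least \<open>card A\<close>.\<close>

lemma fact_card_le_prod: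
  fixes A :: "nat set"
  assumes "finite A" "0 \<notin> A"
  shows "fact (card A) \<le> \<Prod>A"
  using assms
proof (induction "card A" arbitrary: A)
  case 0
  then show ?case by simp
next
  case (Suc k)
  hence ne: "A \<noteq> {}" by auto
  have M: "Max A \<in> A" using Suc ne by simp
  have "A \<subseteq> {1..Max A}" using Suc.prems by (auto simp: Suc_le_eq intro: gr0I)
  hence "card A \<le> Max A" using card_mono[of "{1..Max A}" A] by simp
  moreover have "card (A - {Max A}) = k" using Suc M by simp
  moreover have "fact (card (A - {Max A})) \<le> \<Prod>(A - {Max A})"
    using Suc M by (intro Suc.hyps(1)) auto
  moreover have "\<Prod>A = Max A * \<Prod>(A - {Max A})" using M Suc.prems by (intro prod.remove) auto
  ultimately show ?case using Suc.hyps(2)[symmetric]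
    by (simp add: mult_le_mono del: mult_Suc)
qed

text \<open>The \<open>l\<close> nodes below \<open>y\<close> have distinct positive distances to
  \<open>y\<close>, and so have the \<open>u\<close> nodes above, so the two partial products are at
  least \<open>fact l\<close> and \<open>fact u\<close>; the quotient of \<open>fact (l + u)\<close>
  by these is a binomial coefficient, at most \<open>2 ^ (l + u)\<close>. This bounds the Lagrange
  denominators from below.\<close>

lemma prod_node_distances_ge:
  fixes S :: "nat set"
  assumes S: "finite S" "y \<in> S"
  shows "fact (card S - 1) \<le> 2 ^ (card S - 1) * (\<Prod>z\<in>S - {y}. \<bar>real y - real z\<bar>)"
proof -
  define L where "L = {z\<in>S. z < y}"
  define U where "U = {z\<in>S. y < z}"
  have fin: "finite L" "finite U" using S by (auto simp: L_def U_def)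
  have dec: "S - {y} = L \<union> U" "L \<inter> U = {}" by (auto simp: L_def U_def)
  have cd: "card S - 1 = card L + card U"
    using S dec fin by (metis card_Diff_singleton card_Un_disjoint)
  have 1: "fact (card L) \<le> (\<Prod>z\<in>L. \<bar>real y - real z\<bar>)"
  proof -
    have inj: "inj_on (\<lambda>z. y - z) L" by (auto simp: inj_on_def L_def)
    have "fact (card ((\<lambda>z. y - z) ` L)) \<le> \<Prod>((\<lambda>z. y - z) ` L)"
      by (rule fact_card_le_prod) (use fin in \<open>auto simp: L_def\<close>)
    hence "fact (card L) \<le> (\<Prod>z\<in>L. y - z)" using inj by (simp add: card_image prod.reindex)
    hence "real (fact (card L)) \<le> real (\<Prod>z\<in>L. y - z)" by (simp only: of_nat_le_iff)
    also have "\<dots> = (\<Prod>z\<in>L. \<bar>real y - real z\<bar>)"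
      unfolding of_nat_prod by (intro prod.cong) (auto simp: L_def)
    finally show ?thesis by simp
  qed
  have 2: "fact (card U) \<le> (\<Prod>z\<in>U. \<bar>real y - real z\<bar>)"
  proof -
    have inj: "inj_on (\<lambda>z. z - y) U" by (auto simp: inj_on_def U_def)
    have "fact (card ((\<lambda>z. z - y) ` U)) \<le> \<Prod>((\<lambda>z. z - y) ` U)"
      by (rule fact_card_le_prod) (use fin in \<open>auto simp: U_def\<close>)
    hence "fact (card U) \<le> (\<Prod>z\<in>U. z - y)" using inj by (simp add: card_image prod.reindex)
    hence "real (fact (card U)) \<le> real (\<Prod>z\<in>U. z - y)" by (simp only: of_nat_le_iff)
    also have "\<dots> = (\<Prod>z\<in>U. \<bar>real y - real z\<bar>)"
      unfolding of_nat_prod by (intro prod.cong) (auto simp: U_def)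
    finally show ?thesis by simp
  qed
  have "fact (card L + card U) = fact (card L) * fact (card U) * (card L + card U choose card L)"
    using binomial_fact_lemma[of "card L" "card L + card U"] by simp
  hence "(fact (card L + card U) :: real) =
      fact (card L) * fact (card U) * real (card L + card U choose card L)"
    by (metis of_nat_fact of_nat_mult)
  also have "\<dots> \<le> ((\<Prod>z\<in>L. \<bar>real y - real z\<bar>) * (\<Prod>z\<in>U. \<bar>real y - real z\<bar>)) *
      real (2 ^ (card L + card U))"
    by (intro mult_mono 1 2) (auto simp: binomial_le_pow2 prod_nonneg simp flip: of_nat_le_iff)
  also have "\<dots> = 2 ^ (card S - 1) * (\<Prod>z\<in>S - {y}. \<bar>real y - real z\<bar>)"
    unfolding dec(1) cd using dec(2) fin by (simp add: prod.union_disjoint)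
  finally show ?thesis unfolding cd .
qed

text \<open>Both sides are polynomials in \<open>x\<close> of degree below \<open>card S\<close>
  that agree on \<open>S\<close>.\<close>

lemma lagrange_interpolation:
  fixes p :: "'a :: field poly"
  assumes S: "finite S" "degree p < card S"
  shows "poly p x = (\<Sum>y\<in>S. poly p y * (\<Prod>z\<in>S - {y}. (x - z) / (y - z)))"
proof -
  define l where "l y = (\<Prod>z\<in>S - {y}. smult (inverse (y - z)) [:-z, 1:])" for y
  define q where "q = (\<Sum>y\<in>S. smult (poly p y) (l y))"
  have pl: "poly (l y) u = (\<Prod>z\<in>S - {y}. (u - z) / (y - z))" for y u
    by (simp add: l_def poly_prod divide_inverse algebra_simps)
  have "degree (l y) < card S" if "y \<in> S" for y
  proof -
    have "degree (l y) \<le> (\<Sum>z\<in>S - {y}. degree (smult (inverse (y - z)) [:-z, 1:]))"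
      unfolding l_def using S by (intro order.trans[OF degree_prod_sum_le]) auto
    also have "\<dots> \<le> (\<Sum>z\<in>S - {y}. 1)"
      by (intro sum_mono order.trans[OF degree_smult_le]) auto
    also have "\<dots> < card S" using that S by (auto simp: card_gt_0_iff)
    finally show ?thesis .
  qed
  hence dq: "degree q < card S" unfolding q_def using S
    by (intro degree_sum_less) (auto intro: le_less_trans[OF degree_smult_le])
  have "poly q u = poly p u" if u: "u \<in> S" for u
  proof -
    have "poly q u = (\<Sum>y\<in>S. poly p y * (\<Prod>z\<in>S - {y}. (u - z) / (y - z)))"
      by (simp add: q_def poly_sum pl)
    also have "\<dots> = (\<Sum>y\<in>S. if y = u then poly p u else 0)"
    proof (rule sum.cong)
      fix y assume y: "y \<in> S"
      show "poly p y * (\<Prod>z\<in>S - {y}. (u - z) / (y - z)) = (if y = u then poly p u else 0)"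
      proof (cases "y = u")
        case True
        hence "(\<Prod>z\<in>S - {y}. (u - z) / (y - z)) = 1" by (intro prod.neutral) auto
        then show ?thesis using True by simp
      next
        case False
        hence "(\<Prod>z\<in>S - {y}. (u - z) / (y - z)) = 0" using S u by (intro prod_zero) auto
        then show ?thesis using False by simp
      qed
    qed simp
    also have "\<dots> = poly p u" using S u by simp
    finally show ?thesis .
  qed
  hence "q = p" using S dq by (intro poly_eqI_degree[of S]) auto
  thus ?thesis by (metis (no_types, lifting) q_def poly_sum poly_smult pl sum.cong)
qed

text \<open>One term of the exponential series is at most the whole sum, and Euler's number is at
  most 3. This cancels the factorial coming from the node distances.\<close>

lemma power_le_fact_mult: "real K ^ D \<le> fact D * 3 ^ K"
proof -
  have "real K ^ D / fact D \<le> exp (real K)"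
    using sum_le_suminf[OF summable_exp[of "real K"], of "{D}"] 
    by (simp add: exp_def divide_inverse mult_ac)
  also have "exp (real K) = exp 1 ^ K" by (simp flip: exp_of_nat_mult)
  also have "\<dots> \<le> 3 ^ K" by (intro power_mono exp_le) auto
  finally show ?thesis by (simp add: field_simps)
qed

text \<open>The numerator of a Lagrange basis polynomial is at most \<open>K ^ D\<close> and its
  denominator at least \<open>fact D / 2 ^ D\<close>, so each basis value is at most
  \<open>2 ^ D * 3 ^ K\<close>. With \<open>D + 1 \<le> 2 ^ D\<close> nodes this gives the base
  \<open>12 = 2 * 2 * 3\<close>.\<close>

lemma poly_bound_from_nodes:
  fixes p :: "real poly"
  assumes S: "S \<subseteq> {..K}" "card S = Suc D" "degree p \<le> D"
    and small: "\<And>s. s \<in> S \<Longrightarrow> \<bar>poly p (real s)\<bar> \<le> e" and x: "x \<le> K" and D: "D \<le> K"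
  shows "\<bar>poly p (real x)\<bar> \<le> 12 ^ K * e"
proof -
  have fin: "finite S" using S by (meson finite_atMost finite_subset)
  have e: "e \<ge> 0"
  proof -
    obtain s where "s \<in> S" using S(2) by fastforce
    thus ?thesis using small[of s] by linarith
  qed
  have inj: "inj_on real A" for A by (auto simp: inj_on_def)
  have "poly p (real x) = (\<Sum>y\<in>real ` S. poly p y * (\<Prod>z\<in>real ` S - {y}. (real x - z) / (y - z)))"
    by (rule lagrange_interpolation) (use fin S in \<open>auto simp: card_image inj\<close>)
  also have "\<dots> = (\<Sum>y\<in>S. poly p (real y) * (\<Prod>z\<in>S - {y}. (real x - real z) / (real y - real z)))"
  proof (subst sum.reindex[OF inj], rule sum.cong)
    fix y assume "y \<in> S"
    have "real ` S - {real y} = real ` (S - {y})" by auto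
    thus "((\<lambda>y. poly p y * (\<Prod>z\<in>real ` S - {y}. (real x - z) / (y - z))) \<circ> real) y =
         poly p (real y) * (\<Prod>z\<in>S - {y}. (real x - real z) / (real y - real z))"
      by (simp add: prod.reindex[OF inj])
  qed simp
  finally have eq: "poly p (real x) =
      (\<Sum>y\<in>S. poly p (real y) * (\<Prod>z\<in>S - {y}. (real x - real z) / (real y - real z)))" .
  have "\<bar>poly p (real x)\<bar> \<le>
      (\<Sum>y\<in>S. \<bar>poly p (real y)\<bar> * \<bar>\<Prod>z\<in>S - {y}. (real x - real z) / (real y - real z)\<bar>)"
    unfolding eq by (rule order.trans[OF sum_abs]) (simp add: abs_mult)
  also have "\<dots> \<le> (\<Sum>y\<in>S. e * (2 ^ D * 3 ^ K))"
  proof (rule sum_mono)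
    fix y assume y: "y \<in> S"
    define A where "A = (\<Prod>z\<in>S - {y}. \<bar>real y - real z\<bar>)"
    have A: "A > 0" unfolding A_def by (intro prod_pos) auto
    have "(\<Prod>z\<in>S - {y}. \<bar>real x - real z\<bar>) \<le> (\<Prod>z\<in>S - {y}. real K)"
      by (intro prod_mono) (use S x in \<open>auto simp: abs_le_iff subset_iff\<close>)
    also have "\<dots> = real K ^ D" using S y by simp
    also have "\<dots> \<le> fact D * 3 ^ K" by (rule power_le_fact_mult)
    also have "\<dots> \<le> (2 ^ D * A) * 3 ^ K"
      using prod_node_distances_ge[OF fin y] S by (intro mult_right_mono) (auto simp: A_def)
    finally have "(\<Prod>z\<in>S - {y}. \<bar>real x - real z\<bar>) / A \<le> 2 ^ D * 3 ^ K"
      using A by (simp add: field_simps)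
    hence "\<bar>\<Prod>z\<in>S - {y}. (real x - real z) / (real y - real z)\<bar> \<le> 2 ^ D * 3 ^ K"
      by (simp add: abs_prod A_def prod_dividef)
    thus "\<bar>poly p (real y)\<bar> * \<bar>\<Prod>z\<in>S - {y}. (real x - real z) / (real y - real z)\<bar>
        \<le> e * (2 ^ D * 3 ^ K)"
      using small[OF y] e by (intro mult_mono) auto
  qed
  also have "\<dots> = real (Suc D) * 2 ^ D * 3 ^ K * e" using S by simp
  also have "\<dots> \<le> 2 ^ K * 2 ^ K * 3 ^ K * e"
  proof -
    have "Suc D \<le> 2 ^ D" by (induction D) auto
    hence "real (Suc D) \<le> 2 ^ D" by (metis of_nat_le_iff of_nat_numeral of_nat_power)
    also have "(2::real) ^ D \<le> 2 ^ K" using D by (intro power_increasing) auto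
    finally show ?thesis using D e by (intro mult_mono power_increasing) auto
  qed
  also have "\<dots> = 12 ^ K * e" by (simp flip: power_mult_distrib)
  finally show ?thesis .
qed

lemma gbinomial_poly: "\<exists>p :: real poly. degree p \<le> k \<and> (\<forall>x. poly p x = x gchoose k)"
proof -
  define p :: "real poly" where "p = smult (inverse (fact k)) (\<Prod>i<k. [:- real i, 1:])"
  have "degree (\<Prod>i<k. [:- real i, 1:]) \<le> (\<Sum>i<k. 1)"
    by (intro order.trans[OF degree_prod_sum_le] sum_mono) auto
  hence "degree p \<le> k" unfolding p_def by simp
  moreover have "poly p x = x gchoose k" for x
    by (simp add: p_def poly_prod gbinomial_prod_rev divide_inverse mult_ac atLeast0LessThan)
  ultimately show ?thesis by blast
qed

section \<open>The binomial transform and its inverse\<close>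

lemma binomial_sum_Suc:
  fixes h :: "nat \<Rightarrow> real"
  shows "(\<Sum>j\<le>Suc s. real (Suc s choose j) * h j) =
    (\<Sum>j\<le>s. real (s choose j) * h j) + (\<Sum>j\<le>s. real (s choose j) * h (Suc j))"
proof -
  have "(\<Sum>j\<le>Suc s. real (Suc s choose j) * h j) =
      h 0 + (\<Sum>j\<le>s. real (Suc s choose Suc j) * h (Suc j))"
    by (subst sum.atMost_Suc_shift) simp
  also have "\<dots> = (h 0 + (\<Sum>j\<le>s. real (s choose Suc j) * h (Suc j))) +
      (\<Sum>j\<le>s. real (s choose j) * h (Suc j))"
    by (simp add: sum.distrib algebra_simps)
  also have "h 0 + (\<Sum>j\<le>s. real (s choose Suc j) * h (Suc j)) =
      (\<Sum>j\<le>Suc s. real (s choose j) * h j)"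
    by (subst sum.atMost_Suc_shift) simp
  also have "\<dots> = (\<Sum>j\<le>s. real (s choose j) * h j)" by simp
  finally show ?thesis .
qed

text \<open>The left side is the \<open>a\<close>th forward difference at 0 of the binomial
  transform of \<open>c\<close>. By Pascal's rule one difference of the transform is the transform
  of the sequence shifted by one, which is why \<open>c\<close> is generalized in the
  induction.\<close>

lemma binomial_sum_inversion:
  fixes c :: "nat \<Rightarrow> real"
  shows "(\<Sum>s\<le>a. real (a choose s) * ((- 1) ^ (a - s) * (\<Sum>j\<le>s. real (s choose j) * c j))) = c a"
proof (induction a arbitrary: c)
  case 0
  show ?case by simp
next
  case (Suc a)
  let ?v = "\<lambda>c s. \<Sum>j\<le>s. real (s choose j) * c j"
  have "(\<Sum>s\<le>Suc a. real (Suc a choose s) * ((- 1) ^ (Suc a - s) * ?v c s)) =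
      (\<Sum>s\<le>a. real (a choose s) * ((- 1) ^ (Suc a - s) * ?v c s)) +
      (\<Sum>s\<le>a. real (a choose s) * ((- 1) ^ (a - s) * ?v c (Suc s)))"
    by (subst binomial_sum_Suc) simp
  also have "\<dots> = (\<Sum>s\<le>a. real (a choose s) * ((- 1) ^ (a - s) * ?v (\<lambda>j. c (Suc j)) s))"
    unfolding sum.distrib[symmetric]
    by (intro sum.cong) (simp_all only: binomial_sum_Suc, simp add: Suc_diff_le algebra_simps)
  also have "\<dots> = c (Suc a)" by (rule Suc.IH)
  finally show ?case .
qed

text \<open>If \<open>v\<close> were small at \<open>D + 1\<close> arguments, then so would be the interpolating
  polynomial of degree \<open>D\<close> on all of \<open>{..K}\<close>, hence also its \<open>a\<close>th difference \<open>c a\<close> at \<open>0\<close>.\<close>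

lemma many_large_binomial_sums:
  fixes c :: "nat \<Rightarrow> real"
  assumes aD: "a \<le> D" "D \<le> K"
    and c_small: "\<And>j. D < j \<Longrightarrow> j \<le> K \<Longrightarrow> \<bar>c j\<bar> \<le> \<eta>" and \<eta>: "\<eta> \<ge> 0"
    and c_large: "24 ^ K * (\<epsilon> + 2 ^ K * \<eta>) \<le> \<bar>c a\<bar>"
  shows "K + 1 \<le> card {s\<in>{..K}. \<epsilon> \<le> \<bar>\<Sum>j\<le>s. real (s choose j) * c j\<bar>} + D"
proof (rule ccontr)
  define v where "v s = (\<Sum>j\<le>s. real (s choose j) * c j)" for s
  let ?L = "{s\<in>{..K}. \<epsilon> \<le> \<bar>v s\<bar>}" and ?M = "{s\<in>{..K}. \<bar>v s\<bar> < \<epsilon>}"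
  assume "\<not> ?thesis"
  hence "card ?L + D < K + 1" by (simp add: v_def)
  moreover have "card {..K} = card ?L + card ?M"
  proof -
    have "{..K} = ?L \<union> ?M" by auto
    thus ?thesis by (metis (no_types, lifting) card_Un_disjoint disjoint_iff finite_Un
      finite_atMost linorder_not_less mem_Collect_eq)
  qed
  ultimately have "Suc D \<le> card ?M" by simp
  then obtain S where S: "S \<subseteq> ?M" "card S = Suc D" by (meson obtain_subset_with_card_n)
  obtain b :: "nat \<Rightarrow> real poly" where b: "\<And>k. degree (b k) \<le> k" "\<And>k x. poly (b k) x = x gchoose k"
    using gbinomial_poly by metis
  define p where "p = (\<Sum>j\<le>D. smult (c j) (b j))"
  have dp: "degree p \<le> D"
    unfolding p_def by (intro degree_sum_le) (auto intro: order.trans[OF degree_smult_le] order.trans[OF b(1)])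
  have pv: "poly p (real s) = (\<Sum>j\<le>D. real (s choose j) * c j)" for s
    by (simp add: p_def poly_sum b(2) binomial_gbinomial mult.commute)
  have pvs: "poly p (real s) = v s" if "s \<le> D" for s
    unfolding pv v_def using that by (intro sum.mono_neutral_right) auto
  have diff: "\<bar>poly p (real s) - v s\<bar> \<le> 2 ^ K * \<eta>" if s: "s \<le> K" for s
  proof -
    have "v s = (\<Sum>j\<le>K. real (s choose j) * c j)"
      unfolding v_def using s by (intro sum.mono_neutral_left) auto
    also have "{..K} = {..D} \<union> {D<..K}" using aD by auto
    also have "(\<Sum>j\<in>\<dots>. real (s choose j) * c j) =
        (\<Sum>j\<le>D. real (s choose j) * c j) + (\<Sum>j\<in>{D<..K}. real (s choose j) * c j)"
      by (rule sum.union_disjoint) auto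
    finally have "\<bar>poly p (real s) - v s\<bar> \<le> (\<Sum>j\<in>{D<..K}. \<bar>real (s choose j) * c j\<bar>)"
      unfolding pv using sum_abs[of "\<lambda>j. real (s choose j) * c j" "{D<..K}"] by simp
    also have "\<dots> \<le> (\<Sum>j\<in>{D<..K}. real (K choose j) * \<eta>)"
      using c_small \<eta> binomial_right_mono[OF s]
      by (intro sum_mono) (auto simp: abs_mult intro!: mult_mono)
    also have "\<dots> \<le> (\<Sum>j\<le>K. real (K choose j) * \<eta>)"
      using \<eta> by (intro sum_mono2) auto
    also have "\<dots> = real (\<Sum>j\<le>K. K choose j) * \<eta>" by (simp add: sum_distrib_right)
    also have "\<dots> = 2 ^ K * \<eta>" by (simp add: choose_row_sum)
    finally show ?thesis .
  qed
  have fin: "finite S" using S(2) card.infinite by fastforce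
  have "S \<noteq> {}" using S(2) by auto
  \<comment> \<open>The maximum is attained at a node, where \<open>v\<close> is strictly below
    \<open>\<epsilon>\<close>; the resulting strict bound on \<open>e\<close> contradicts the
    non-strict \<open>c_large\<close>.\<close>
  define e where "e = Max ((\<lambda>s. \<bar>poly p (real s)\<bar>) ` S)"
  have e: "\<bar>poly p (real s)\<bar> \<le> e" if "s \<in> S" for s
    unfolding e_def using that fin by (intro Max_ge) auto
  have "e \<in> (\<lambda>s. \<bar>poly p (real s)\<bar>) ` S"
    unfolding e_def using fin \<open>S \<noteq> {}\<close> by (intro Max_in) auto
  then obtain s where s: "s \<in> S" "e = \<bar>poly p (real s)\<bar>" by blast
  have "\<bar>v s\<bar> < \<epsilon>" "s \<le> K" using s(1) S(1) by auto
  hence e_less: "e < \<epsilon> + 2 ^ K * \<eta>" using diff[of s] s(2) by linarith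
  have SK: "S \<subseteq> {..K}" using S(1) by auto
  have vs: "\<bar>v s\<bar> \<le> 12 ^ K * e" if "s \<le> a" for s
    using poly_bound_from_nodes[OF SK S(2) dp e, of s] that aD pvs[of s] by simp
  have e0: "e \<ge> 0" using e[OF s(1)] by linarith
  \<comment> \<open>Inversion costs the factor \<open>2 ^ a\<close>, which raises the base 12 of the
    interpolation to 24.\<close>
  have "\<bar>c a\<bar> \<le> (\<Sum>s\<le>a. \<bar>real (a choose s) * ((- 1) ^ (a - s) * v s)\<bar>)"
    using sum_abs[of "\<lambda>s. real (a choose s) * ((- 1) ^ (a - s) * v s)" "{..a}"]
      binomial_sum_inversion[of a c] by (simp add: v_def)
  also have "\<dots> \<le> (\<Sum>s\<le>a. real (a choose s) * (12 ^ K * e))"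
    by (intro sum_mono) (auto simp: abs_mult power_abs intro!: mult_left_mono vs)
  also have "\<dots> = real (\<Sum>s\<le>a. a choose s) * (12 ^ K * e)" by (simp add: sum_distrib_right)
  also have "\<dots> = 2 ^ a * (12 ^ K * e)" by (simp add: choose_row_sum)
  also have "\<dots> \<le> 2 ^ K * (12 ^ K * e)"
    using aD e0 by (intro mult_right_mono power_increasing) auto
  also have "\<dots> = 24 ^ K * e" by (simp flip: power_mult_distrib mult.assoc)
  also have "\<dots> < 24 ^ K * (\<epsilon> + 2 ^ K * \<eta>)" using e_less by simp
  finally show False using c_large by simp
qed

section \<open>Shift operators on the simplex lattice\<close>

definition harmonic :: "nat \<Rightarrow> nat \<Rightarrow> ((nat \<Rightarrow> nat) \<Rightarrow> real) \<Rightarrow> bool" where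
  "harmonic n N g \<longleftrightarrow>
     (\<forall>\<beta> \<in> simplex_lattice n (N - 1). (\<Sum>i=1..n. g (\<lambda>j. \<beta> j + coord_vec i j)) = 0)"

text \<open>The equation at \<open>a\<close> minus the \<open>i\<close>th unit vector writes
  \<open>g a\<close> as minus a sum of \<open>n - 1\<close> values, one of which must have modulus
  at least \<open>\<bar>g a\<bar> / n\<close>.\<close>

lemma cone_step:
  assumes g: "harmonic n N g" and a: "a \<in> simplex_lattice n N"
    and i: "i \<in> {1..n}" "a i \<ge> 1" and n: "n \<ge> 2"
  shows "\<exists>b\<in>simplex_lattice n N. b i = a i - 1 \<and> (\<forall>k. k \<noteq> i \<longrightarrow> a k \<le> b k) \<and>
     \<bar>g a\<bar> \<le> real n * \<bar>g b\<bar>"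
proof -
  define \<beta> where "\<beta> = (\<lambda>j. a j - coord_vec i j)"
  define up where "up = (\<lambda>k j. \<beta> j + coord_vec k j)"
  have coord_sum: "(\<Sum>j=1..n. coord_vec k j) = 1" if "k \<in> {1..n}" for k
    using that by (simp add: coord_vec_def sum.delta)
  have upi: "up i = a"
    using i by (auto simp: up_def \<beta>_def coord_vec_def)
  have "(\<Sum>j=1..n. \<beta> j) + 1 = (\<Sum>j=1..n. up i j)"
    using coord_sum[OF i(1)] by (simp add: up_def sum.distrib)
  hence sb: "(\<Sum>j=1..n. \<beta> j) + 1 = N" using a upi by (simp add: simplex_lattice_def)
  have \<beta>: "\<beta> \<in> simplex_lattice n (N - 1)"
    using sb a by (auto simp: simplex_lattice_def \<beta>_def)
  have up: "up k \<in> simplex_lattice n N" if "k \<in> {1..n}" for k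
    using that sb \<beta> coord_sum[OF that]
    by (auto simp: simplex_lattice_def up_def sum.distrib coord_vec_def)
  have "(\<Sum>k\<in>{1..n}. g (up k)) = 0"
    using g \<beta> by (simp add: harmonic_def up_def)
  moreover have "(\<Sum>k\<in>{1..n}. g (up k)) = g (up i) + (\<Sum>k\<in>{1..n} - {i}. g (up k))"
    by (rule sum.remove) (use i in auto)
  ultimately have "g a = - (\<Sum>k\<in>{1..n} - {i}. g (up k))"
    unfolding upi by linarith
  hence le: "\<bar>g a\<bar> \<le> (\<Sum>k\<in>{1..n} - {i}. \<bar>g (up k)\<bar>)" by simp
  have "\<exists>k\<in>{1..n} - {i}. \<bar>g a\<bar> \<le> real n * \<bar>g (up k)\<bar>"
  proof (rule ccontr)
    assume "\<not> ?thesis"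
    hence small: "\<bar>g (up k)\<bar> < \<bar>g a\<bar> / real n" if "k \<in> {1..n} - {i}" for k
      using that n by (force simp: field_simps)
    have ne: "{1..n} - {i} \<noteq> {}"
    proof
      assume "{1..n} - {i} = {}"
      hence "{1..n} = {i}" using i(1) by blast
      hence "card {1..n} = 1" by simp
      thus False using n by simp
    qed
    have "(\<Sum>k\<in>{1..n} - {i}. \<bar>g (up k)\<bar>) < (\<Sum>k\<in>{1..n} - {i}. \<bar>g a\<bar> / real n)"
      by (rule sum_strict_mono) (use ne small in auto)
    also have "\<dots> = real (n - 1) * (\<bar>g a\<bar> / real n)" using i(1) by simp
    also have "\<dots> \<le> real n * (\<bar>g a\<bar> / real n)" by (rule mult_right_mono) auto
    also have "\<dots> = \<bar>g a\<bar>" using n by simp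
    finally show False using le by simp
  qed
  then obtain k where k: "k \<in> {1..n} - {i}" "\<bar>g a\<bar> \<le> real n * \<bar>g (up k)\<bar>" by blast
  show ?thesis
    by (rule bexI[of _ "up k"])
       (use k up i in \<open>auto simp: up_def \<beta>_def coord_vec_def\<close>)
qed

text \<open>Iteration of \<open>cone_step\<close>. It serves with \<open>i = 1\<close>, to lower the
  first coordinate to a prescribed layer while no other coordinate decreases.\<close>

lemma cone_property:
  assumes g: "harmonic n N g" and a: "a \<in> simplex_lattice n N"
    and i: "i \<in> {1..n}" and n: "n \<ge> 2" and d: "d \<le> a i"
  shows "\<exists>b\<in>simplex_lattice n N. b i = a i - d \<and> (\<forall>k. k \<noteq> i \<longrightarrow> a k \<le> b k) \<and>
     \<bar>g a\<bar> \<le> real n ^ d * \<bar>g b\<bar>"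
  using d
proof (induction d)
  case 0
  show ?case by (rule bexI[OF _ a]) auto
next
  case (Suc d)
  then obtain b where b: "b \<in> simplex_lattice n N" "b i = a i - d"
    "\<And>k. k \<noteq> i \<Longrightarrow> a k \<le> b k" "\<bar>g a\<bar> \<le> real n ^ d * \<bar>g b\<bar>" by auto
  have bi: "b i \<ge> 1" using b(2) Suc.prems by simp
  obtain c where c: "c \<in> simplex_lattice n N" "c i = b i - 1"
    "\<And>k. k \<noteq> i \<Longrightarrow> b k \<le> c k" "\<bar>g b\<bar> \<le> real n * \<bar>g c\<bar>"
    using cone_step[OF g b(1) i bi n] by blast
  have "\<bar>g a\<bar> \<le> real n ^ d * (real n * \<bar>g c\<bar>)"
    by (rule order.trans[OF b(4)]) (intro mult_left_mono c(4), auto)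
  hence "\<bar>g a\<bar> \<le> real n ^ Suc d * \<bar>g c\<bar>" by (simp add: mult_ac)
  moreover have "a k \<le> c k" if "k \<noteq> i" for k
    using b(3)[OF that] c(3)[OF that] by linarith
  ultimately show ?case using c(1,2) b(2) by (intro bexI[of _ c]) auto
qed

section \<open>Powers of the tail shifts\<close>

definition up :: "nat \<Rightarrow> (nat \<Rightarrow> nat) \<Rightarrow> nat \<Rightarrow> nat" where
  "up j \<alpha> = \<alpha>(j := Suc (\<alpha> j))"

text \<open>The operator \<open>D\<^sub>i\<close> of the overview, acting on functions of all
  multi-indices so that its powers need no domain conditions.\<close>

definition tail_shift :: "nat \<Rightarrow> nat \<Rightarrow> ((nat \<Rightarrow> nat) \<Rightarrow> real) \<Rightarrow> (nat \<Rightarrow> nat) \<Rightarrow> real" where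
  "tail_shift n i F \<alpha> = (\<Sum>j=i..n. F (up j \<alpha>))"

lemma tail_shift_split:
  "i \<le> n \<Longrightarrow> tail_shift n i F \<alpha> = F (up i \<alpha>) + tail_shift n (Suc i) F \<alpha>"
  by (simp add: tail_shift_def sum.atLeast_Suc_atMost)

text \<open>The binomial theorem for the commuting operators \<open>E\<^sub>i\<close> and
  \<open>D\<^sub>i\<^sub>+\<^sub>1\<close>, the shifts \<open>E\<^sub>i\<close> being carried out in
  the argument. Along a line on which \<open>\<alpha> i + s\<close> is constant, the summands depend
  on \<open>s\<close> only through the binomial coefficient, so this is a binomial
  transform.\<close>

lemma tail_shift_power_binomial:
  assumes i: "i \<le> n"
  shows "(tail_shift n i ^^ s) F \<alpha> =
    (\<Sum>j\<le>s. real (s choose j) * (tail_shift n (Suc i) ^^ j) F (\<alpha>(i := \<alpha> i + (s - j))))"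
proof (induction s arbitrary: \<alpha>)
  case 0
  show ?case by simp
next
  case (Suc s)
  define h where "h j = (tail_shift n (Suc i) ^^ j) F (\<alpha>(i := \<alpha> i + (Suc s - j)))" for j
  have "(tail_shift n i ^^ Suc s) F \<alpha> =
      (tail_shift n i ^^ s) F (up i \<alpha>) + (\<Sum>k=Suc i..n. (tail_shift n i ^^ s) F (up k \<alpha>))"
    using tail_shift_split[OF i, of "(tail_shift n i ^^ s) F" \<alpha>] by (simp add: tail_shift_def)
  also have "(tail_shift n i ^^ s) F (up i \<alpha>) = (\<Sum>j\<le>s. real (s choose j) * h j)"
    unfolding Suc.IH by (intro sum.cong) (auto simp: h_def up_def Suc_diff_le)
  also have "(\<Sum>k=Suc i..n. (tail_shift n i ^^ s) F (up k \<alpha>)) =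
      (\<Sum>k=Suc i..n. \<Sum>j\<le>s. real (s choose j) *
        (tail_shift n (Suc i) ^^ j) F (up k (\<alpha>(i := \<alpha> i + (s - j)))))"
    unfolding Suc.IH
    by (intro sum.cong refl arg_cong2[where f = "(*)"] arg_cong[where f = "(tail_shift n (Suc i) ^^ j) F" for j])
       (auto simp: up_def fun_eq_iff)
  also have "\<dots> = (\<Sum>j\<le>s. real (s choose j) * h (Suc j))"
    by (subst sum.swap) (simp add: h_def tail_shift_def sum_distrib_left)
  also have "(\<Sum>j\<le>s. real (s choose j) * h j) + (\<Sum>j\<le>s. real (s choose j) * h (Suc j)) =
      (\<Sum>j\<le>Suc s. real (Suc s choose j) * h j)"
    by (rule binomial_sum_Suc[symmetric])
  finally show ?case by (simp only: h_def)
qed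

text \<open>Expanding the power gives at most \<open>n ^ s\<close> values of \<open>F\<close>, at
  points obtained from \<open>\<alpha>\<close> by raising coordinates of index at least
  \<open>i\<close>.\<close>

lemma tail_shift_power_bound:
  assumes i: "i \<ge> 1"
    and F: "\<And>\<beta>. (\<And>j. j < i \<Longrightarrow> \<beta> j = \<alpha> j) \<Longrightarrow> (\<And>j. \<alpha> j \<le> \<beta> j) \<Longrightarrow> \<bar>F \<beta>\<bar> \<le> \<eta>"
  shows "\<bar>(tail_shift n i ^^ s) F \<alpha>\<bar> \<le> real n ^ s * \<eta>"
  using F
proof (induction s arbitrary: \<alpha>)
  case 0
  then show ?case by simp
next
  case (Suc s)
  have \<eta>: "\<eta> \<ge> 0" using Suc.prems[of \<alpha>] by fastforce
  have "\<bar>(tail_shift n i ^^ Suc s) F \<alpha>\<bar> \<le> (\<Sum>k=i..n. \<bar>(tail_shift n i ^^ s) F (up k \<alpha>)\<bar>)"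
    by (simp add: tail_shift_def)
  also have "\<dots> \<le> (\<Sum>k=i..n. real n ^ s * \<eta>)"
  proof (rule sum_mono)
    fix k assume k: "k \<in> {i..n}"
    show "\<bar>(tail_shift n i ^^ s) F (up k \<alpha>)\<bar> \<le> real n ^ s * \<eta>"
    proof (rule Suc.IH)
      fix \<beta> assume \<beta>: "\<And>j. j < i \<Longrightarrow> \<beta> j = up k \<alpha> j" "\<And>j. up k \<alpha> j \<le> \<beta> j"
      have "\<alpha> j \<le> up k \<alpha> j" for j by (simp add: up_def)
      thus "\<bar>F \<beta>\<bar> \<le> \<eta>"
        using \<beta> k by (intro Suc.prems) (auto simp: up_def intro: order.trans)
    qed
  qed
  also have "\<dots> = real (Suc n - i) * (real n ^ s * \<eta>)" by simp
  also have "\<dots> \<le> real n * (real n ^ s * \<eta>)"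
    using i \<eta> by (intro mult_right_mono) auto
  finally show ?case by (simp add: mult_ac)
qed

definition zero_ext :: "nat \<Rightarrow> nat \<Rightarrow> ((nat \<Rightarrow> nat) \<Rightarrow> real) \<Rightarrow> (nat \<Rightarrow> nat) \<Rightarrow> real" where
  "zero_ext n N g \<alpha> = (if \<alpha> \<in> simplex_lattice n N then g \<alpha> else 0)"

lemma sum_up: "j \<in> {1..n} \<Longrightarrow> (\<Sum>k=1..n. up j \<alpha> k) = Suc (\<Sum>k=1..n. \<alpha> k)"
  by (subst (1 2) sum.remove[of _ j]) (auto simp: up_def)

lemma up_mem_simplex_iff:
  assumes "j \<in> {1..n}"
  shows "up j \<alpha> \<in> simplex_lattice n (Suc N) \<longleftrightarrow> \<alpha> \<in> simplex_lattice n N"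
proof -
  have "(\<forall>i. i \<notin> {1..n} \<longrightarrow> up j \<alpha> i = 0) \<longleftrightarrow> (\<forall>i. i \<notin> {1..n} \<longrightarrow> \<alpha> i = 0)"
    using assms by (auto simp: up_def)
  thus ?thesis unfolding simplex_lattice_def mem_Collect_eq sum_up[OF assms] by simp
qed

text \<open>Outside layer \<open>N - 1\<close> no neighbour \<open>up k \<alpha>\<close> lies in the
  simplex, so the sum vanishes there too and the operator identities hold without boundary
  terms.\<close>

lemma tail_shift_zero_ext:
  assumes g: "harmonic n N g" and N: "N \<ge> 1"
  shows "tail_shift n 1 (zero_ext n N g) \<alpha> = 0"
proof -
  obtain N' where N': "N = Suc N'" using N by (cases N) auto
  have eq: "up k \<alpha> = (\<lambda>j. \<alpha> j + coord_vec k j)" for k by (auto simp: up_def coord_vec_def)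
  show ?thesis
  proof (cases "\<alpha> \<in> simplex_lattice n N'")
    case True
    hence "(\<Sum>k=1..n. g (up k \<alpha>)) = 0" using g N' by (simp add: harmonic_def eq)
    moreover have "tail_shift n 1 (zero_ext n N g) \<alpha> = (\<Sum>k=1..n. g (up k \<alpha>))"
      unfolding tail_shift_def
      by (intro sum.cong) (use True in \<open>auto simp: zero_ext_def N' up_mem_simplex_iff\<close>)
    ultimately show ?thesis by simp
  next
    case False
    thus ?thesis unfolding tail_shift_def
      by (intro sum.neutral) (auto simp: zero_ext_def N' up_mem_simplex_iff)
  qed
qed

text \<open>The operator \<open>D\<^sub>1 = E\<^sub>1 + D\<^sub>2\<close> annihilates the extension,
  so \<open>D\<^sub>2\<close> acts on it as \<open>- E\<^sub>1\<close>; since the two commute, the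
  same holds for powers.\<close>

lemma tail_shift_2_power_zero_ext:
  assumes g: "harmonic n N g" and N: "N \<ge> 1" and n: "n \<ge> 1"
  shows "(tail_shift n 2 ^^ a) (zero_ext n N g) \<alpha> =
    (- 1) ^ a * zero_ext n N g (\<alpha>(1 := \<alpha> 1 + a))"
proof (induction a arbitrary: \<alpha>)
  case 0
  show ?case by simp
next
  case (Suc a)
  let ?G = "zero_ext n N g"
  have "(tail_shift n 2 ^^ Suc a) ?G \<alpha> = (\<Sum>k=2..n. (tail_shift n 2 ^^ a) ?G (up k \<alpha>))"
    by (simp add: tail_shift_def)
  also have "\<dots> = (\<Sum>k=2..n. (- 1) ^ a * ?G (up k (\<alpha>(1 := \<alpha> 1 + a))))"
    unfolding Suc.IH by (intro sum.cong refl arg_cong2[where f = "(*)"] arg_cong[where f = ?G])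
      (auto simp: up_def fun_eq_iff)
  also have "\<dots> = (- 1) ^ a * tail_shift n (Suc 1) ?G (\<alpha>(1 := \<alpha> 1 + a))"
    by (simp add: tail_shift_def sum_distrib_left numeral_2_eq_2)
  also have "tail_shift n (Suc 1) ?G (\<alpha>(1 := \<alpha> 1 + a)) = - ?G (up 1 (\<alpha>(1 := \<alpha> 1 + a)))"
    using tail_shift_split[OF n, of ?G "\<alpha>(1 := \<alpha> 1 + a)"] tail_shift_zero_ext[OF g N]
    by (simp add: add_eq_0_iff)
  also have "up 1 (\<alpha>(1 := \<alpha> 1 + a)) = \<alpha>(1 := \<alpha> 1 + Suc a)"
    by (auto simp: up_def fun_eq_iff)
  finally show ?case
    by (simp only: power_Suc mult_minus_left mult_minus_right mult_1_left)
qed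

section \<open>Separated sets\<close>

text \<open>Distance at least \<open>t\<close> in the maximum norm, without truncated
  subtraction.\<close>

definition apart :: "nat \<Rightarrow> (nat \<Rightarrow> nat) \<Rightarrow> (nat \<Rightarrow> nat) \<Rightarrow> bool" where
  "apart t \<alpha> \<beta> \<longleftrightarrow> (\<exists>j. \<alpha> j + t \<le> \<beta> j \<or> \<beta> j + t \<le> \<alpha> j)"

definition separated :: "nat \<Rightarrow> (nat \<Rightarrow> nat) set \<Rightarrow> bool" where
  "separated t P \<longleftrightarrow> (\<forall>\<alpha>\<in>P. \<forall>\<beta>\<in>P. \<alpha> \<noteq> \<beta> \<longrightarrow> apart t \<alpha> \<beta>)"

lemma apart_irrefl: "t \<ge> 1 \<Longrightarrow> \<not> apart t \<alpha> \<alpha>"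
  by (simp add: apart_def)

lemma separated_UN:
  assumes "\<And>x. x \<in> X \<Longrightarrow> separated t (P x)"
    and "\<And>x y \<alpha> \<beta>. x \<in> X \<Longrightarrow> y \<in> X \<Longrightarrow> x \<noteq> y \<Longrightarrow> \<alpha> \<in> P x \<Longrightarrow> \<beta> \<in> P y \<Longrightarrow> apart t \<alpha> \<beta>"
  shows "separated t (\<Union>x\<in>X. P x)"
  using assms unfolding separated_def by (metis UN_E)

lemma card_UN_apart:
  assumes "finite X" "t \<ge> 1" "\<And>x. x \<in> X \<Longrightarrow> finite (P x)"
    and "\<And>x y \<alpha> \<beta>. x \<in> X \<Longrightarrow> y \<in> X \<Longrightarrow> x \<noteq> y \<Longrightarrow> \<alpha> \<in> P x \<Longrightarrow> \<beta> \<in> P y \<Longrightarrow> apart t \<alpha> \<beta>"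
  shows "card (\<Union>x\<in>X. P x) = (\<Sum>x\<in>X. card (P x))"
proof (rule card_UN_disjoint)
  show "\<forall>x\<in>X. \<forall>y\<in>X. x \<noteq> y \<longrightarrow> P x \<inter> P y = {}"
    using assms apart_irrefl by blast
qed (use assms in auto)

text \<open>Greedy choice: keep the least element \<open>x\<close>, discard the at most
  \<open>t\<close> elements of \<open>{x..<x+t}\<close>, and recurse.\<close>

lemma spaced_subset:
  fixes A :: "nat set"
  assumes "finite A" "t \<ge> 1"
  shows "\<exists>B\<subseteq>A. (\<forall>x\<in>B. \<forall>y\<in>B. x < y \<longrightarrow> x + t \<le> y) \<and> card A \<le> t * card B"
  using assms(1)
proof (induction "card A" arbitrary: A rule: less_induct)
  case less
  show ?case
  proof (cases "A = {}")
    case False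
    define x where "x = Min A"
    define A' where "A' = {y\<in>A. x + t \<le> y}"
    have x: "x \<in> A" "\<And>y. y \<in> A \<Longrightarrow> x \<le> y" using less.prems False by (auto simp: x_def)
    have fin: "finite A'" using less.prems by (simp add: A'_def)
    have "x \<notin> A'" using \<open>t \<ge> 1\<close> by (simp add: A'_def)
    moreover have "A' \<subseteq> A" unfolding A'_def by blast
    ultimately have "A' \<subset> A" using x(1) by blast
    hence "card A' < card A" using less.prems by (simp add: psubset_card_mono)
    from less.hyps[OF this fin] obtain B where
      B: "B \<subseteq> A'" "\<forall>x\<in>B. \<forall>y\<in>B. x < y \<longrightarrow> x + t \<le> y" "card A' \<le> t * card B" by blast
    have "A \<subseteq> A' \<union> {x..<x+t}" using x by (auto simp: A'_def)
    hence "card A \<le> card (A' \<union> {x..<x+t})" using fin by (intro card_mono) auto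
    also have "\<dots> \<le> card A' + t" using card_Un_le[of A' "{x..<x+t}"] by simp
    also have "\<dots> \<le> t * card B + t" using B(3) by simp
    also have "\<dots> = t * card (insert x B)"
    proof -
      have "x \<notin> B" "finite B" using B(1) \<open>x \<notin> A'\<close> fin by (auto intro: finite_subset)
      thus ?thesis by simp
    qed
    finally show ?thesis
      using B x(1) \<open>A' \<subset> A\<close> by (intro exI[of _ "insert x B"]) (fastforce simp: A'_def subset_iff)
  qed auto
qed

section \<open>Large values near a point with decay\<close>

text \<open>This is the hypothesis \<open>c_large\<close> of \<open>many_large_binomial_sums\<close>
  for one stage of the descent. \<open>Q ^ M\<close> absorbs \<open>2 * 24 ^ K\<close>, and
  \<open>B ^ M\<close> absorbs \<open>2 * (48 * n) ^ K\<close> together with the accumulated powers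
  of \<open>Q\<close>, so each summand takes at most half of the right side.\<close>

lemma threshold_recursion:
  fixes Q B x :: real
  assumes Q: "Q = 2 * 24 ^ (n + 1)" and B: "B \<ge> 2 * (48 * real n) ^ (n + 1) * Q ^ n"
    and K: "K \<le> (n + 1) * M" and M: "M \<ge> 1" and r: "r \<le> n" and n: "n \<ge> 1" and x: "x \<ge> 0"
  shows "24 ^ K * (x / Q ^ (Suc r * M) + 2 ^ K * (real n ^ K * (x / B ^ M))) \<le> x / Q ^ (r * M)"
proof -
  have Q1: "Q \<ge> 1"
    unfolding Q using one_le_power[of "24::real" "n + 1"] by linarith
  have two: "(2::real) \<le> 2 ^ M" using power_increasing[OF M, of "2::real"] by simp
  have B0: "B > 0"
    by (rule less_le_trans[OF _ B]) (use Q1 n in auto)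
  have 1: "24 ^ K * 2 \<le> Q ^ M"
  proof -
    have "(24::real) ^ K \<le> 24 ^ ((n + 1) * M)" using K by (intro power_increasing) auto
    hence "(24::real) ^ K * 2 \<le> 24 ^ ((n + 1) * M) * 2 ^ M" using two by (intro mult_mono) auto
    also have "\<dots> = Q ^ M" by (simp only: Q power_mult_distrib power_mult[of 24 "n + 1" M]) (rule mult.commute)
    finally show ?thesis .
  qed
  have 2: "(48 * real n) ^ K * 2 * Q ^ (r * M) \<le> B ^ M"
  proof -
    have "(48 * real n) ^ K \<le> (48 * real n) ^ ((n + 1) * M)"
      using K n by (intro power_increasing) auto
    moreover have "Q ^ (r * M) \<le> Q ^ (n * M)" using r Q1 by (intro power_increasing) auto
    ultimately have "(48 * real n) ^ K * 2 * Q ^ (r * M) \<le>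
        (48 * real n) ^ ((n + 1) * M) * 2 ^ M * Q ^ (n * M)"
      using two Q1 by (intro mult_mono) auto
    also have "\<dots> = (2 * (48 * real n) ^ (n + 1) * Q ^ n) ^ M"
      unfolding power_mult[of "48 * real n" "n + 1" M] power_mult[of Q n M]
      by (simp only: power_mult_distrib[of _ _ M] mult_ac)
    also have "\<dots> \<le> B ^ M" using B Q1 by (intro power_mono) auto
    finally show ?thesis .
  qed
  have e: "(24::real) ^ K * 2 ^ K * real n ^ K = (48 * real n) ^ K"
    by (simp only: power_mult_distrib[symmetric]) simp
  have "24 ^ K * (x / Q ^ (Suc r * M)) = (24 ^ K * 2) * (x / (2 * (Q ^ M * Q ^ (r * M))))"
    by (simp add: power_add)
  also have "\<dots> \<le> Q ^ M * (x / (2 * (Q ^ M * Q ^ (r * M))))"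
    using 1 x Q1 by (intro mult_right_mono) auto
  also have "\<dots> = x / (2 * Q ^ (r * M))" using Q1 by simp
  finally have p1: "24 ^ K * (x / Q ^ (Suc r * M)) \<le> x / (2 * Q ^ (r * M))" .
  have "24 ^ K * (2 ^ K * (real n ^ K * (x / B ^ M))) = (48 * real n) ^ K * (x / B ^ M)"
    unfolding e[symmetric] by (simp only: mult_ac)
  also have "\<dots> \<le> x / (2 * Q ^ (r * M))"
  proof -
    have "(48 * real n) ^ K * 2 * Q ^ (r * M) * x \<le> B ^ M * x" using 2 x by (rule mult_right_mono)
    thus ?thesis using B0 Q1 by (simp add: field_simps)
  qed
  finally have p2: "24 ^ K * (2 ^ K * (real n ^ K * (x / B ^ M))) \<le> x / (2 * Q ^ (r * M))" .
  show ?thesis using p1 p2 by (simp add: distrib_left)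
qed

text \<open>The last assumption is the decay of \<open>g\<close> when coordinate \<open>i\<close> drops below \<open>b i\<close> by more than \<open>m div 4\<close>;
  the other coordinates may drop by \<open>m\<close> in the directions in \<open>H\<close> only.\<close>

locale decaying_point =
  fixes n N m :: nat and g :: "(nat \<Rightarrow> nat) \<Rightarrow> real" and b :: "nat \<Rightarrow> nat" and H :: "nat set"
    and Q B :: real and low :: "nat \<Rightarrow> nat"
  defines "low \<equiv> \<lambda>j. if j \<in> H then m else 0"
  assumes n: "n \<ge> 2" and N: "N \<ge> 1" and harm: "harmonic n N g" and b: "b \<in> simplex_lattice n N"
    and H: "H \<subseteq> {2..n}" "\<And>j. j \<in> H \<Longrightarrow> m \<le> b j"
    and Q: "Q = 2 * 24 ^ (n + 1)" and B: "B \<ge> 2 * (48 * real n) ^ (n + 1) * Q ^ n"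
    and decay: "\<And>i \<alpha>. i \<in> H \<Longrightarrow> \<alpha> \<in> simplex_lattice n N \<Longrightarrow> \<alpha> 1 = b 1 \<Longrightarrow>
      (\<And>j. j \<in> {2..<i} \<Longrightarrow> \<alpha> j = b j) \<Longrightarrow> (\<And>j. j \<in> {2..n} \<Longrightarrow> b j \<le> \<alpha> j + low j) \<Longrightarrow>
      \<alpha> i + m div 4 < b i \<Longrightarrow> B ^ Suc m * \<bar>g \<alpha>\<bar> \<le> \<bar>g b\<bar>"
begin

abbreviation "G \<equiv> zero_ext n N g"

text \<open>A multi-index \<open>w\<close> with \<open>w 1 = b 1\<close> and an order \<open>a\<close> of the operator are encoded together
  as the lattice point \<open>z = w(1 := b 1 + a)\<close>.\<close>

definition admissible :: "nat \<Rightarrow> (nat \<Rightarrow> nat) \<Rightarrow> bool" where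
  "admissible i z \<longleftrightarrow> z \<in> simplex_lattice n N \<and> b 1 \<le> z 1 \<and> z 1 \<le> b 1 + (n + 1 - i) * m \<and>
     (\<forall>j\<in>{2..<i}. z j = b j) \<and> (\<forall>j\<in>{2..n}. b j \<le> z j + low j) \<and>
     \<bar>g b\<bar> \<le> Q ^ ((n + 1 - i) * Suc m) * \<bar>(tail_shift n i ^^ (z 1 - b 1)) G (z(1 := b 1))\<bar>"

text \<open>One stage of the descent: the order \<open>z 1 - b 1\<close> is exchanged for
  \<open>s\<close>, and coordinate \<open>i\<close>, equal to \<open>b i\<close> before, takes up
  the difference, so that the coordinate sum is preserved.\<close>

definition move :: "nat \<Rightarrow> (nat \<Rightarrow> nat) \<Rightarrow> nat \<Rightarrow> nat \<Rightarrow> nat" where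
  "move i z s = z(1 := b 1 + s, i := b i + (z 1 - b 1) - s)"

lemma Q_pos: "Q > 0" by (simp add: Q)

lemma B_pos: "B > 0"
  by (rule less_le_trans[OF _ B]) (use Q_pos n in auto)

lemma low_le: "i \<in> {2..n} \<Longrightarrow> low i \<le> b i" "low i \<le> m"
  using H by (auto simp: low_def)

text \<open>On the line in direction \<open>i\<close> the powers form a binomial transform with
  entries \<open>c\<close>, to which \<open>many_large_binomial_sums\<close> applies:
  \<open>c a\<close> is large by the previous stage, and for \<open>j > a + low i div 4\<close> the
  decay makes \<open>c j\<close> tiny.\<close>

lemma many_large_moves:
  assumes i: "i \<in> {2..n}" and z: "admissible (Suc i) z"
  defines "a \<equiv> z 1 - b 1"
  shows "low i + 1 \<le> card {s\<in>{..a + low i}. \<bar>g b\<bar> / Q ^ ((n + 1 - i) * Suc m) \<le>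
      \<bar>(tail_shift n i ^^ s) G (z(1 := b 1, i := b i + a - s))\<bar>} + low i div 4"
proof -
  define K where "K = a + low i"
  define D where "D = a + low i div 4"
  define c where "c j = (tail_shift n (Suc i) ^^ j) G (z(1 := b 1, i := b i + a - j))" for j
  define \<eta> where "\<eta> = real n ^ K * (\<bar>g b\<bar> / B ^ Suc m)"
  define \<epsilon> where "\<epsilon> = \<bar>g b\<bar> / Q ^ ((n + 1 - i) * Suc m)"
  have z': "z \<in> simplex_lattice n N" "b 1 \<le> z 1" "z 1 \<le> b 1 + (n - i) * m"
    "\<And>j. j \<in> {2..<Suc i} \<Longrightarrow> z j = b j" "\<And>j. j \<in> {2..n} \<Longrightarrow> b j \<le> z j + low j"
    "\<bar>g b\<bar> \<le> Q ^ ((n - i) * Suc m) * \<bar>(tail_shift n (Suc i) ^^ a) G (z(1 := b 1))\<bar>"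
    using z by (auto simp: admissible_def a_def)
  have zi: "z i = b i" using z'(4) i by auto
  have i1: "i \<noteq> 1" "1 \<noteq> i" using i by auto
  have KD: "a \<le> D" "D \<le> K" by (auto simp: K_def D_def)
  have Kb: "K \<le> b i + a" using low_le(1)[OF i] by (simp add: K_def)
  have v: "(tail_shift n i ^^ s) G (z(1 := b 1, i := b i + a - s)) =
      (\<Sum>j\<le>s. real (s choose j) * c j)" if "s \<le> K" for s
  proof -
    have "(z(1 := b 1, i := b i + a - s))(i := b i + a - s + (s - j)) =
        z(1 := b 1, i := b i + a - j)" if "j \<le> s" for j
      using that \<open>s \<le> K\<close> Kb by (intro ext) auto
    moreover have "i \<le> n" using i by simp
    ultimately show ?thesis
      unfolding tail_shift_power_binomial[OF \<open>i \<le> n\<close>] c_def by (intro sum.cong) auto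
  qed
  have ca: "c a = (tail_shift n (Suc i) ^^ a) G (z(1 := b 1))"
    unfolding c_def using zi i1 by (intro arg_cong[where f = "(tail_shift n (Suc i) ^^ a) G"]) auto
  have c_small: "\<bar>c j\<bar> \<le> \<eta>" if j: "D < j" "j \<le> K" for j
  proof -
    \<comment> \<open>Outside \<open>H\<close>, \<open>low i = 0\<close> makes \<open>D = K\<close>,
      so no such \<open>j\<close> exists.\<close>
    have iH: "i \<in> H" using j by (auto simp: D_def K_def low_def split: if_splits)
    hence low_i: "low i = m" by (simp add: low_def)
    have "\<bar>c j\<bar> \<le> real n ^ j * (\<bar>g b\<bar> / B ^ Suc m)"
      unfolding c_def
    proof (rule tail_shift_power_bound)
      fix \<beta> assume \<beta>: "\<And>k. k < Suc i \<Longrightarrow> \<beta> k = (z(1 := b 1, i := b i + a - j)) k"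
        "\<And>k. (z(1 := b 1, i := b i + a - j)) k \<le> \<beta> k"
      show "\<bar>G \<beta>\<bar> \<le> \<bar>g b\<bar> / B ^ Suc m"
      proof (cases "\<beta> \<in> simplex_lattice n N")
        case True
        have bi: "\<beta> i = b i + a - j" using \<beta>(1)[of i] by simp
        have "B ^ Suc m * \<bar>g \<beta>\<bar> \<le> \<bar>g b\<bar>"
        proof (rule decay[OF iH True])
          show "\<beta> 1 = b 1" using \<beta>(1)[of 1] i by auto
          show "\<beta> k = b k" if "k \<in> {2..<i}" for k
            using that \<beta>(1)[of k] z'(4)[of k] by auto
          show "\<beta> i + m div 4 < b i" unfolding bi using j Kb by (auto simp: D_def low_i)
          show "b k \<le> \<beta> k + low k" if k: "k \<in> {2..n}" for k
          proof (cases "k = i")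
            case True
            thus ?thesis using bi j by (auto simp: K_def)
          next
            case False
            hence "z k \<le> \<beta> k" using \<beta>(2)[of k] k by (auto split: if_splits)
            thus ?thesis using z'(5)[OF k] by linarith
          qed
        qed
        hence "\<bar>g \<beta>\<bar> \<le> \<bar>g b\<bar> / B ^ Suc m" using B_pos by (simp add: field_simps)
        thus ?thesis using True by (simp add: zero_ext_def)
      qed (use B_pos in \<open>simp add: zero_ext_def\<close>)
    qed simp
    also have "\<dots> \<le> \<eta>" unfolding \<eta>_def
      using j(2) n B_pos by (intro mult_right_mono power_increasing) auto
    finally show ?thesis .
  qed
  have "24 ^ K * (\<epsilon> + 2 ^ K * \<eta>) \<le> \<bar>g b\<bar> / Q ^ ((n - i) * Suc m)"
  proof -
    have "n + 1 - i = Suc (n - i)" using i by auto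
    moreover have "K \<le> (n + 1) * Suc m"
    proof -
      have "K \<le> (n - i) * m + m" using z'(2,3) low_le(2)[of i] by (simp add: K_def a_def)
      also have "\<dots> = (n - i + 1) * m" by simp
      also have "\<dots> \<le> (n + 1) * Suc m" by (intro mult_le_mono) auto
      finally show ?thesis .
    qed
    \<comment> \<open>\<open>Suc m\<close> is substituted for \<open>M\<close>, which has to be
      positive even if \<open>m = 0\<close>.\<close>
    ultimately show ?thesis unfolding \<epsilon>_def \<eta>_def
      using threshold_recursion[OF Q B, of K "Suc m" "n - i" "\<bar>g b\<bar>"] n by simp
  qed
  also have "\<dots> \<le> \<bar>c a\<bar>"
    using z'(6) Q_pos by (simp add: ca field_simps)
  finally have "K + 1 \<le> card {s\<in>{..K}. \<epsilon> \<le> \<bar>\<Sum>j\<le>s. real (s choose j) * c j\<bar>} + D"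
    using KD c_small B_pos by (intro many_large_binomial_sums[of a]) (auto simp: \<eta>_def)
  also have "{s\<in>{..K}. \<epsilon> \<le> \<bar>\<Sum>j\<le>s. real (s choose j) * c j\<bar>} =
      {s\<in>{..K}. \<epsilon> \<le> \<bar>(tail_shift n i ^^ s) G (z(1 := b 1, i := b i + a - s))\<bar>}"
    using v by auto
  finally show ?thesis by (simp add: K_def D_def \<epsilon>_def)
qed

lemma simplex_move:
  assumes i: "i \<in> {2..n}" and z: "admissible (Suc i) z" and s: "s \<le> b i + (z 1 - b 1)"
  shows "move i z s \<in> simplex_lattice n N"
proof -
  have z': "z \<in> simplex_lattice n N" "b 1 \<le> z 1" "z i = b i"
    using z i by (auto simp: admissible_def)
  have *: "(\<Sum>k=1..n. f k) = f 1 + (f i + (\<Sum>k\<in>{1..n} - {1} - {i}. f k))" for f :: "nat \<Rightarrow> nat"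
    using i by (subst sum.remove[of _ 1], simp, simp, subst sum.remove[of _ i]) auto
  have "(\<Sum>k\<in>{1..n} - {1} - {i}. move i z s k) = (\<Sum>k\<in>{1..n} - {1} - {i}. z k)"
    by (intro sum.cong) (auto simp: move_def)
  hence "(\<Sum>k=1..n. move i z s k) = (\<Sum>k=1..n. z k)"
    unfolding * using z' s i by (auto simp: move_def)
  moreover have "move i z s k = z k" if "k \<notin> {1..n}" for k
    using that i by (auto simp: move_def)
  ultimately show ?thesis using z'(1) unfolding simplex_lattice_def by simp
qed

text \<open>\<open>many_large_moves\<close> guarantees \<open>low i + 1 - low i div 4\<close>
  orders, at least half of \<open>low i + 1\<close>, whence the factor 2. Thinning them out by
  \<open>spaced_subset\<close> costs the factor \<open>t\<close>.\<close>

lemma spaced_moves: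
  assumes i: "i \<in> {2..n}" and z: "admissible (Suc i) z" and t: "t \<ge> 1"
  shows "\<exists>S. finite S \<and> S \<noteq> {} \<and> (\<forall>s\<in>S. s \<le> b i + (z 1 - b 1) \<and> admissible i (move i z s)) \<and>
    (\<forall>x\<in>S. \<forall>y\<in>S. x < y \<longrightarrow> x + t \<le> y) \<and> low i + 1 \<le> 2 * t * card S"
proof -
  define a where "a = z 1 - b 1"
  define A where "A = {s\<in>{..a + low i}. \<bar>g b\<bar> / Q ^ ((n + 1 - i) * Suc m) \<le>
      \<bar>(tail_shift n i ^^ s) G (z(1 := b 1, i := b i + a - s))\<bar>}"
  have A: "low i + 1 \<le> card A + low i div 4"
    using many_large_moves[OF i z] by (simp add: A_def a_def)
  have "finite A" by (simp add: A_def)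
  from spaced_subset[OF this t] obtain S where
    S: "S \<subseteq> A" "\<forall>x\<in>S. \<forall>y\<in>S. x < y \<longrightarrow> x + t \<le> y" "card A \<le> t * card S" by blast
  have cnt: "low i + 1 \<le> 2 * (t * card S)" using A S(3) by linarith
  have fin: "finite S" using S(1) \<open>finite A\<close> by (rule finite_subset)
  have "S \<noteq> {}" using cnt by auto
  moreover have "s \<le> b i + a \<and> admissible i (move i z s)" if "s \<in> S" for s
  proof -
    have s: "s \<le> a + low i" "\<bar>g b\<bar> / Q ^ ((n + 1 - i) * Suc m) \<le>
      \<bar>(tail_shift n i ^^ s) G (z(1 := b 1, i := b i + a - s))\<bar>"
      using that S(1) by (auto simp: A_def)
    have sb: "s \<le> b i + a" using s(1) low_le(1)[OF i] by simp
    have i1: "i \<noteq> 1" "1 \<noteq> i" using i by auto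
    have z': "b 1 \<le> z 1" "z 1 \<le> b 1 + (n - i) * m"
      "\<And>j. j \<in> {2..<Suc i} \<Longrightarrow> z j = b j" "\<And>j. j \<in> {2..n} \<Longrightarrow> b j \<le> z j + low j"
      using z by (auto simp: admissible_def a_def)
    have m1: "move i z s 1 = b 1 + s" using i1 by (simp add: move_def)
    have eq: "(move i z s)(1 := b 1) = z(1 := b 1, i := b i + a - s)"
      using i1 by (auto simp: move_def a_def fun_eq_iff)
    have "s \<le> (n - i) * m + m" using s(1) z' low_le(2)[of i] by (simp add: a_def)
    also have "\<dots> = (n + 1 - i) * m" using i by (simp add: Suc_diff_le)
    finally have up1: "s \<le> (n + 1 - i) * m" .
    have "b j \<le> move i z s j + low j" if j: "j \<in> {2..n}" for j
      using z'(4)[OF j] j s(1) by (auto simp: move_def a_def)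
    moreover have "\<bar>g b\<bar> \<le> Q ^ ((n + 1 - i) * Suc m) *
        \<bar>(tail_shift n i ^^ (move i z s 1 - b 1)) G ((move i z s)(1 := b 1))\<bar>"
      using s(2) Q_pos unfolding eq m1 by (simp add: field_simps)
    moreover have "move i z s j = b j" if "j \<in> {2..<i}" for j
      using z'(3)[of j] that by (auto simp: move_def)
    ultimately show ?thesis
      using simplex_move[OF i z] sb up1 unfolding admissible_def m1 a_def by simp
  qed
  ultimately show ?thesis using fin S(2) cnt unfolding a_def by (intro exI[of _ S]) auto
qed

text \<open>Since \<open>s + move i z s i = b i + (z 1 - b 1)\<close>, a gap of \<open>2 * t\<close> between the old orders leaves a
  gap of \<open>t\<close> between the new orders or in coordinate \<open>i\<close>.\<close>

lemma move_apart:
  assumes i: "i \<in> {2..n}" and z: "admissible (Suc i) z" "admissible (Suc i) y"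
    and s: "s \<le> b i + (z 1 - b 1)" "r \<le> b i + (y 1 - b 1)" and "apart (2 * t) z y"
  shows "apart t (move i z s) (move i y r)"
proof -
  have *: "apart t (move i z s) (move i y r)"
    if z: "admissible (Suc i) z" "admissible (Suc i) y"
    and s: "s \<le> b i + (z 1 - b 1)" "r \<le> b i + (y 1 - b 1)" and j: "z j + 2 * t \<le> y j" for z y s r j
  proof -
    have i1: "i \<noteq> 1" "1 \<noteq> i" using i by auto
    have zi: "z i = b i" "y i = b i" "b 1 \<le> z 1" "b 1 \<le> y 1"
      using z i by (auto simp: admissible_def)
    consider "j = 1" | "j = i" | "j \<noteq> 1" "j \<noteq> i" by blast
    thus ?thesis
    proof cases
      case 1
      have m: "move i z s 1 = b 1 + s" "move i z s i = b i + (z 1 - b 1) - s"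
        "move i y r 1 = b 1 + r" "move i y r i = b i + (y 1 - b 1) - r"
        using i1 by (simp_all add: move_def)
      have "b 1 + s + t \<le> b 1 + r \<or> b i + (z 1 - b 1) - s + t \<le> b i + (y 1 - b 1) - r"
        using j 1 s zi by auto
      thus ?thesis unfolding apart_def m[symmetric] by blast
    next
      case 2
      hence "t = 0" using j zi by simp
      thus ?thesis by (simp add: apart_def nat_le_linear)
    next
      case 3
      hence "move i z s j + t \<le> move i y r j" using j by (simp add: move_def)
      thus ?thesis unfolding apart_def by blast
    qed
  qed
  have sym: "apart t \<alpha> \<beta> \<longleftrightarrow> apart t \<beta> \<alpha>" for \<alpha> \<beta> by (auto simp: apart_def)
  from assms(6) obtain j where "z j + 2 * t \<le> y j \<or> y j + 2 * t \<le> z j" by (auto simp: apart_def)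
  thus ?thesis using *[OF z s] *[OF z(2,1) s(2,1)] sym by blast
qed

text \<open>Downward induction on \<open>i\<close> from the singleton \<open>{b}\<close> at
  \<open>i = Suc n\<close>. By \<open>move_apart\<close> each stage halves the separation, hence the
  power of 2. A stage in \<open>H\<close> multiplies the count by at least
  \<open>Suc m / (2 ^ n * t)\<close>; any other stage does not lower it.\<close>

lemma admissible_family:
  assumes t: "t \<ge> 1" and i: "2 \<le> i" "i \<le> Suc n"
  shows "\<exists>Z. finite Z \<and> Z \<noteq> {} \<and> (\<forall>z\<in>Z. admissible i z) \<and> separated (t * 2 ^ (i - 2)) Z \<and>
    Suc m ^ card (H \<inter> {i..n}) \<le> (2 ^ n * t) ^ card (H \<inter> {i..n}) * card Z"
  using i(2)
proof (induction rule: inc_induct)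
  case base
  have "admissible (Suc n) b" using b by (auto simp: admissible_def zero_ext_def)
  thus ?case by (intro exI[of _ "{b}"]) (auto simp: separated_def)
next
  case (step k)
  define \<sigma> where "\<sigma> = t * 2 ^ (k - 2)"
  have k: "k \<in> {2..n}" using step i(1) by auto
  have "t * 2 ^ (Suc k - 2) = 2 * \<sigma>" using k
    by (cases k; cases "k - 1") (auto simp: \<sigma>_def)
  with step.IH obtain Z where Z: "finite Z" "Z \<noteq> {}" "\<And>z. z \<in> Z \<Longrightarrow> admissible (Suc k) z"
    "separated (2 * \<sigma>) Z"
    "Suc m ^ card (H \<inter> {Suc k..n}) \<le> (2 ^ n * t) ^ card (H \<inter> {Suc k..n}) * card Z" by auto
  have \<sigma>: "\<sigma> \<ge> 1" using t by (simp add: \<sigma>_def)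
  have "\<forall>z\<in>Z. \<exists>S. finite S \<and> S \<noteq> {} \<and>
    (\<forall>s\<in>S. s \<le> b k + (z 1 - b 1) \<and> admissible k (move k z s)) \<and>
    (\<forall>x\<in>S. \<forall>y\<in>S. x < y \<longrightarrow> x + \<sigma> \<le> y) \<and> low k + 1 \<le> 2 * \<sigma> * card S"
    using spaced_moves[OF k Z(3) \<sigma>] by blast
  from bchoice[OF this] obtain S where "\<forall>z\<in>Z. finite (S z) \<and> S z \<noteq> {} \<and>
    (\<forall>s\<in>S z. s \<le> b k + (z 1 - b 1) \<and> admissible k (move k z s)) \<and>
    (\<forall>x\<in>S z. \<forall>y\<in>S z. x < y \<longrightarrow> x + \<sigma> \<le> y) \<and> low k + 1 \<le> 2 * \<sigma> * card (S z)"
    by blast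
  hence S: "\<And>z. z \<in> Z \<Longrightarrow> finite (S z)"
    "\<And>z. z \<in> Z \<Longrightarrow> S z \<noteq> {}" "\<And>z s. z \<in> Z \<Longrightarrow> s \<in> S z \<Longrightarrow> s \<le> b k + (z 1 - b 1)"
    "\<And>z s. z \<in> Z \<Longrightarrow> s \<in> S z \<Longrightarrow> admissible k (move k z s)"
    "\<And>z x y. z \<in> Z \<Longrightarrow> x \<in> S z \<Longrightarrow> y \<in> S z \<Longrightarrow> x < y \<Longrightarrow> x + \<sigma> \<le> y"
    "\<And>z. z \<in> Z \<Longrightarrow> low k + 1 \<le> 2 * \<sigma> * card (S z)" by blast+
  have k1: "1 \<noteq> k" "k \<noteq> 1" using k by auto
  define Y where "Y = (\<Union>z\<in>Z. move k z ` S z)"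
  have mv1: "move k z s 1 = b 1 + s" for z s using k1 by (simp add: move_def)
  have inj: "inj_on (move k z) A" for z A
    by (rule inj_onI) (metis mv1 add_left_cancel)
  have ap: "apart \<sigma> \<alpha> \<beta>" if "x \<in> Z" "y \<in> Z" "x \<noteq> y" "\<alpha> \<in> move k x ` S x" "\<beta> \<in> move k y ` S y"
    for x y \<alpha> \<beta>
    using that Z(3,4) S(3) by (auto intro!: move_apart[OF k] simp: separated_def)
  \<comment> \<open>Different moves of one point have different orders, and these are visible in
    coordinate 1.\<close>
  have "separated \<sigma> (move k z ` S z)" if z: "z \<in> Z" for z
  proof -
    have "apart \<sigma> (move k z x) (move k z y)" if "x \<in> S z" "y \<in> S z" "x \<noteq> y" for x y
    proof -
      have "x + \<sigma> \<le> y \<or> y + \<sigma> \<le> x" using S(5)[OF z] that by (meson linorder_neqE_nat)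
      thus ?thesis unfolding apart_def using mv1 by (intro exI[of _ 1]) auto
    qed
    thus ?thesis by (auto simp: separated_def)
  qed
  hence "separated \<sigma> Y" unfolding Y_def using ap by (intro separated_UN) auto
  moreover have "finite Y" "Y \<noteq> {}" using Z S by (auto simp: Y_def)
  moreover have "\<forall>z\<in>Y. admissible k z" using S(4) by (auto simp: Y_def)
  moreover have "card Z * (low k + 1) \<le> 2 * \<sigma> * card Y"
  proof -
    have "card Y = (\<Sum>z\<in>Z. card (move k z ` S z))"
      unfolding Y_def using Z S \<sigma> ap by (intro card_UN_apart[of _ \<sigma>]) auto
    also have "\<dots> = (\<Sum>z\<in>Z. card (S z))" by (simp add: card_image[OF inj])
    finally have "2 * \<sigma> * card Y = (\<Sum>z\<in>Z. 2 * \<sigma> * card (S z))" by (simp add: sum_distrib_left)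
    also have "\<dots> \<ge> (\<Sum>z\<in>Z. low k + 1)" using S(6) by (intro sum_mono) auto
    finally show ?thesis by simp
  qed
  moreover have "card Z \<le> card Y"
  proof -
    have "card Z = (\<Sum>z\<in>Z. 1)" by simp
    also have "\<dots> \<le> (\<Sum>z\<in>Z. card (move k z ` S z))"
      using S(1,2) by (intro sum_mono) (auto simp: Suc_le_eq card_gt_0_iff)
    also have "\<dots> = card Y"
      unfolding Y_def using Z S \<sigma> ap by (intro card_UN_apart[of _ \<sigma>, symmetric]) auto
    finally show ?thesis .
  qed
  moreover have "2 * \<sigma> \<le> 2 ^ n * t"
  proof -
    have "(2::nat) * 2 ^ (k - 2) = 2 ^ (k - 1)" using k
      by (metis One_nat_def Suc_diff_Suc Suc_le_lessD atLeastAtMost_iff numeral_2_eq_2 power_Suc)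
    also have "\<dots> \<le> 2 ^ n" using k by (intro power_increasing) auto
    finally show ?thesis by (simp add: \<sigma>_def)
  qed
  ultimately have Y: "finite Y" "Y \<noteq> {}" "\<forall>z\<in>Y. admissible k z" "separated \<sigma> Y"
    "card Z * (low k + 1) \<le> 2 * \<sigma> * card Y" "card Z \<le> card Y" "2 * \<sigma> \<le> 2 ^ n * t"
    by blast+
  have "Suc m ^ card (H \<inter> {k..n}) \<le> (2 ^ n * t) ^ card (H \<inter> {k..n}) * card Y"
  proof (cases "k \<in> H")
    case True
    have "H \<inter> {k..n} = insert k (H \<inter> {Suc k..n})" using True k by auto
    hence c: "card (H \<inter> {k..n}) = Suc (card (H \<inter> {Suc k..n}))" by simp
    have "Suc m ^ card (H \<inter> {k..n}) \<le>
        Suc m * ((2 ^ n * t) ^ card (H \<inter> {Suc k..n}) * card Z)"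
      unfolding c power_Suc using Z(5) by (intro mult_le_mono) auto
    also have "\<dots> = (2 ^ n * t) ^ card (H \<inter> {Suc k..n}) * (card Z * (low k + 1))"
      using True by (simp add: low_def algebra_simps)
    also have "\<dots> \<le> (2 ^ n * t) ^ card (H \<inter> {Suc k..n}) * ((2 ^ n * t) * card Y)"
      by (rule mult_le_mono2, rule order.trans[OF Y(5)], rule mult_le_mono1, rule Y(7))
    finally show ?thesis unfolding c power_Suc by (simp only: mult_ac)
  next
    case False
    moreover have "{k..n} = insert k {Suc k..n}" using k by auto
    ultimately have "H \<inter> {k..n} = H \<inter> {Suc k..n}" by simp
    thus ?thesis using order.trans[OF Z(5) mult_le_mono2[OF Y(6)]] by simp
  qed
  thus ?case using Y by (intro exI[of _ Y]) (auto simp: \<sigma>_def)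
qed

text \<open>At \<open>i = 2\<close> the operator is a power of \<open>D\<^sub>2\<close>, up to sign
  a shift in direction 1 that takes \<open>z(1 := b 1)\<close> back to \<open>z\<close>. This is the
  purpose of the encoding: \<open>g\<close> itself is large at the encoded points.\<close>

lemma separated_block:
  assumes t: "t \<ge> 1"
  shows "\<exists>P. finite P \<and> P \<noteq> {} \<and> separated t P \<and> Suc m ^ card H \<le> (2 ^ n * t) ^ card H * card P \<and>
    (\<forall>\<alpha>\<in>P. \<alpha> \<in> simplex_lattice n N \<and> b 1 \<le> \<alpha> 1 \<and> (\<forall>j\<in>{2..n}. b j \<le> \<alpha> j + low j) \<and>
       \<bar>g b\<bar> \<le> Q ^ (n * Suc m) * \<bar>g \<alpha>\<bar>)"
proof -
  obtain Z where Z: "finite Z" "Z \<noteq> {}" "\<And>z. z \<in> Z \<Longrightarrow> admissible 2 z" "separated t Z"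
    "Suc m ^ card (H \<inter> {2..n}) \<le> (2 ^ n * t) ^ card (H \<inter> {2..n}) * card Z"
    using admissible_family[OF t, of 2] n by auto
  have "\<bar>g b\<bar> \<le> Q ^ (n * Suc m) * \<bar>g z\<bar>" if "z \<in> Z" for z
  proof -
    have z: "z \<in> simplex_lattice n N" "b 1 \<le> z 1"
      "\<bar>g b\<bar> \<le> Q ^ ((n + 1 - 2) * Suc m) * \<bar>(tail_shift n 2 ^^ (z 1 - b 1)) G (z(1 := b 1))\<bar>"
      using Z(3)[OF that] by (auto simp: admissible_def)
    have "\<bar>(tail_shift n 2 ^^ (z 1 - b 1)) G (z(1 := b 1))\<bar> = \<bar>g z\<bar>"
      using z tail_shift_2_power_zero_ext[OF harm N, of "z 1 - b 1" "z(1 := b 1)"] n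
      by (simp add: zero_ext_def abs_mult power_abs)
    hence "\<bar>g b\<bar> \<le> Q ^ ((n + 1 - 2) * Suc m) * \<bar>g z\<bar>" using z(3) by simp
    also have "\<dots> \<le> Q ^ (n * Suc m) * \<bar>g z\<bar>"
    proof -
      have "(1::real) \<le> 24 ^ (n + 1)" by (rule one_le_power) simp
      thus ?thesis using n by (intro mult_right_mono power_increasing mult_le_mono) (auto simp: Q)
    qed
    finally show ?thesis .
  qed
  moreover have "H \<inter> {2..n} = H" using H by auto
  ultimately show ?thesis
    using Z by (intro exI[of _ Z]) (auto simp: admissible_def)
qed

end

section \<open>Separated families of large values\<close>

text \<open>Take for \<open>m\<close> the \<open>q\<close>th smallest value of \<open>d\<close>:
  fewer than \<open>q\<close> of the \<open>2 * q\<close> values lie below it, so at least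
  \<open>q + 1\<close> do not.\<close>

lemma split_at_rank:
  fixes d :: "'a \<Rightarrow> nat"
  assumes A: "finite A" "card A = 2 * q" and q: "q \<ge> 1"
  shows "\<exists>m J H. J \<subseteq> A \<and> H \<subseteq> A \<and> card J = q \<and> card H = Suc q \<and> (\<forall>j\<in>J. d j \<le> m) \<and> (\<forall>j\<in>H. m \<le> d j)"
proof -
  define Q where "Q m \<longleftrightarrow> q \<le> card {j\<in>A. d j \<le> m}" for m
  have "{j\<in>A. d j \<le> (\<Sum>j\<in>A. d j)} = A" using A by (auto intro: member_le_sum)
  hence "Q (\<Sum>j\<in>A. d j)" using A by (simp add: Q_def)
  define m where "m = (LEAST m. Q m)"
  have m: "Q m" unfolding m_def by (rule LeastI) fact
  have "card {j\<in>A. d j < m} < q"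
  proof (cases m)
    case 0
    thus ?thesis using q by simp
  next
    case (Suc k)
    hence "\<not> Q k" unfolding m_def by (metis lessI not_less_Least)
    thus ?thesis by (simp add: Q_def Suc less_Suc_eq_le)
  qed
  moreover have "card {j\<in>A. d j < m} + card {j\<in>A. m \<le> d j} = 2 * q"
    unfolding A(2)[symmetric] using A(1)
    by (subst card_Un_disjoint[symmetric]) (auto intro!: arg_cong[of _ _ card])
  ultimately have "Suc q \<le> card {j\<in>A. m \<le> d j}" by simp
  then obtain H where "H \<subseteq> {j\<in>A. m \<le> d j}" "card H = Suc q" by (meson obtain_subset_with_card_n)
  moreover obtain J where "J \<subseteq> {j\<in>A. d j \<le> m}" "card J = q"
    using m unfolding Q_def by (meson obtain_subset_with_card_n)
  ultimately show ?thesis by (intro exI[of _ m] exI[of _ J] exI[of _ H]) auto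
qed

text \<open>As in Vitali's lemma, keep a box of largest side \<open>R u\<close> and discard all
  corners within less than about \<open>R u\<close> of its corner in every direction of
  \<open>I\<close>. These number at most \<open>(2 * R u) ^ card I\<close>, because corners are
  determined by their coordinates in \<open>I\<close>; the remaining boxes are no larger, hence
  disjoint from the kept one.\<close>

lemma greedy_disjoint_boxes:
  fixes x :: "'a \<Rightarrow> 'b \<Rightarrow> nat" and R :: "'a \<Rightarrow> nat"
  assumes "finite X" and I: "finite I"
    and "\<And>u v. u \<in> X \<Longrightarrow> v \<in> X \<Longrightarrow> (\<And>j. j \<in> I \<Longrightarrow> x u j = x v j) \<Longrightarrow> u = v"
    and R: "\<And>u. u \<in> X \<Longrightarrow> R u \<ge> 1"
  shows "\<exists>Y\<subseteq>X. (\<forall>u\<in>Y. \<forall>v\<in>Y. u \<noteq> v \<longrightarrow> (\<exists>j\<in>I. x u j + R u \<le> x v j \<or> x v j + R v \<le> x u j)) \<and>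
    card X \<le> (\<Sum>u\<in>Y. (2 * R u) ^ card I)"
  using assms(1,3,4)
proof (induction "card X" arbitrary: X rule: less_induct)
  case less
  show ?case
  proof (cases "X = {}")
    case False
    have "Max (R ` X) \<in> R ` X" using less.prems False by (intro Max_in) auto
    then obtain u where u: "u \<in> X" "R u = Max (R ` X)" by auto
    have Ru: "R v \<le> R u" if "v \<in> X" for v unfolding u(2) using that less.prems by (intro Max_ge) auto
    define far where "far v \<longleftrightarrow> (\<exists>j\<in>I. x u j + R u \<le> x v j \<or> x v j + R u \<le> x u j)" for v
    define X' where "X' = {v\<in>X. far v}"
    define D where "D = {v\<in>X. \<not> far v}"
    have fin: "finite X'" "finite D" using less.prems by (auto simp: X'_def D_def)
    have "\<not> far u" using less.prems(3)[OF u(1)] by (auto simp: far_def)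
    hence uX': "u \<notin> X'" "X' \<subseteq> X" by (auto simp: X'_def)
    hence "X' \<subset> X" using u(1) by blast
    hence "card X' < card X" using less.prems by (simp add: psubset_card_mono)
    have "\<exists>Y\<subseteq>X'. (\<forall>u\<in>Y. \<forall>v\<in>Y. u \<noteq> v \<longrightarrow>
        (\<exists>j\<in>I. x u j + R u \<le> x v j \<or> x v j + R v \<le> x u j)) \<and>
        card X' \<le> (\<Sum>u\<in>Y. (2 * R u) ^ card I)"
    proof (rule less.hyps[OF \<open>card X' < card X\<close> fin(1)])
      show "v = w" if "v \<in> X'" "w \<in> X'" "\<And>j. j \<in> I \<Longrightarrow> x v j = x w j" for v w
        using that uX'(2) by (intro less.prems(2)) auto
      show "1 \<le> R v" if "v \<in> X'" for v using that uX'(2) by (intro less.prems(3)) auto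
    qed
    then obtain Y where Y: "Y \<subseteq> X'"
      "\<forall>u\<in>Y. \<forall>v\<in>Y. u \<noteq> v \<longrightarrow> (\<exists>j\<in>I. x u j + R u \<le> x v j \<or> x v j + R v \<le> x u j)"
      "card X' \<le> (\<Sum>u\<in>Y. (2 * R u) ^ card I)" by blast
    have uY: "u \<notin> Y" "finite Y" using Y(1) uX' fin(1) by (auto intro: finite_subset)
    have "card D \<le> (2 * R u) ^ card I"
    proof -
      \<comment> \<open>Truncation of \<open>x u j - R u\<close> at 0 only shortens the
        interval.\<close>
      let ?P = "PiE I (\<lambda>j. {x u j - R u..<x u j + R u})"
      have "inj_on (\<lambda>v. restrict (x v) I) D"
      proof (rule inj_onI)
        fix v w assume vw: "v \<in> D" "w \<in> D" "restrict (x v) I = restrict (x w) I"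
        hence "x v j = x w j" if "j \<in> I" for j using that by (metis restrict_apply')
        thus "v = w" using vw by (intro less.prems(2)) (auto simp: D_def)
      qed
      moreover have "(\<lambda>v. restrict (x v) I) ` D \<subseteq> ?P"
        by (auto simp: D_def far_def not_le)
      moreover have "finite ?P" using I by (intro finite_PiE) auto
      ultimately have "card D \<le> card ?P" by (rule card_inj_on_le)
      also have "\<dots> = (\<Prod>j\<in>I. card {x u j - R u..<x u j + R u})" using I by (rule card_PiE)
      also have "\<dots> \<le> (\<Prod>j\<in>I. 2 * R u)" by (intro prod_mono) auto
      finally show ?thesis by simp
    qed
    moreover have "card X \<le> card D + card X'"
    proof -
      have "X = D \<union> X'" by (auto simp: D_def X'_def)
      thus ?thesis by (metis card_Un_le)
    qed
    ultimately have c: "card X \<le> (\<Sum>u\<in>insert u Y. (2 * R u) ^ card I)"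
      using Y(3) uY by simp
    have far': "\<exists>j\<in>I. x u j + R u \<le> x v j \<or> x v j + R v \<le> x u j" if "v \<in> Y" for v
    proof -
      have "v \<in> X" "far v" using that Y(1) by (auto simp: X'_def)
      thus ?thesis using Ru[of v] unfolding far_def by (meson add_left_mono order.trans)
    qed
    have "\<forall>a\<in>insert u Y. \<forall>v\<in>insert u Y. a \<noteq> v \<longrightarrow>
        (\<exists>j\<in>I. x a j + R a \<le> x v j \<or> x v j + R v \<le> x a j)"
      using Y(2) far' by blast
    thus ?thesis using c Y(1) uX'(2) u(1) by (intro exI[of _ "insert u Y"]) auto
  qed auto
qed

text \<open>The geometric weights make the loss \<open>\<alpha> i < b i\<close> outweigh all gains in later coordinates.\<close>

lemma weight_drop:
  fixes \<alpha> b :: "nat \<Rightarrow> nat"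
  assumes i: "i \<in> {2..n}" and L: "L \<ge> 8 * (n + 2)"
    and before: "\<And>j. j \<in> {2..<i} \<Longrightarrow> \<alpha> j = b j"
    and at: "\<alpha> i + m div 4 < b i" "b i \<le> \<alpha> i + m"
    and after: "\<And>j. j \<in> {i<..n} \<Longrightarrow> b j \<le> \<alpha> j + m"
    and sums: "(\<Sum>j=i..n. \<alpha> j) = (\<Sum>j=i..n. b j)"
  shows "(\<Sum>j=2..n. L ^ (n - j) * \<alpha> j) + Suc m \<le> (\<Sum>j=2..n. L ^ (n - j) * b j)"
proof -
  have split: "(\<Sum>j=i..n. f j) = f i + (\<Sum>j\<in>{i<..n}. f j)" for f :: "nat \<Rightarrow> nat"
    using i by (simp add: sum.head)
  have split2: "(\<Sum>j=2..n. f j) = (\<Sum>j=2..<i. f j) + (f i + (\<Sum>j\<in>{i<..n}. f j))"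
    for f :: "nat \<Rightarrow> nat"
  proof -
    have "{2..n} = {2..<i} \<union> {i..n}" using i by auto
    hence "(\<Sum>j=2..n. f j) = (\<Sum>j=2..<i. f j) + (\<Sum>j=i..n. f j)"
      by (simp only:) (rule sum.union_disjoint, auto)
    thus ?thesis by (simp only: split)
  qed
  \<comment> \<open>For \<open>i = n\<close> the equality of the sums would read
    \<open>\<alpha> n = b n\<close>.\<close>
  have "i \<noteq> n" using sums at(1) by auto
  hence "i < n" using i by auto
  define \<mu> where "\<mu> = L ^ (n - Suc i)"
  have "\<mu> \<ge> 1" using L by (simp add: \<mu>_def)
  have \<kappa>i: "L ^ (n - i) = L * \<mu>"
    using \<open>i < n\<close> by (simp add: \<mu>_def Suc_diff_Suc flip: power_Suc)
  define \<delta> where "\<delta> = b i - \<alpha> i"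
  have \<delta>: "b i = \<alpha> i + \<delta>" "\<delta> \<le> m" "m + 1 \<le> 4 * \<delta>" using at by (auto simp: \<delta>_def)
  \<comment> \<open>Weights beyond \<open>i\<close> are at most \<open>\<mu>\<close>, and the equal
    sums fix the total of the surpluses \<open>\<alpha> j + m - b j\<close>: it is
    \<open>\<delta> + (n - i) * m\<close>.\<close>
  have tail: "(\<Sum>j\<in>{i<..n}. L ^ (n - j) * \<alpha> j) \<le> (\<Sum>j\<in>{i<..n}. L ^ (n - j) * b j) + \<mu> * (n * m)"
  proof -
    have "(\<Sum>j\<in>{i<..n}. L ^ (n - j) * \<alpha> j) \<le>
        (\<Sum>j\<in>{i<..n}. L ^ (n - j) * b j + \<mu> * (\<alpha> j + m - b j))"
    proof (rule sum_mono)
      fix j assume j: "j \<in> {i<..n}"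
      have "L ^ (n - j) \<le> \<mu>" unfolding \<mu>_def using L j by (intro power_increasing) auto
      moreover have "L ^ (n - j) * \<alpha> j \<le> L ^ (n - j) * (b j + (\<alpha> j + m - b j))"
        by (intro mult_le_mono2) simp
      ultimately show "L ^ (n - j) * \<alpha> j \<le> L ^ (n - j) * b j + \<mu> * (\<alpha> j + m - b j)"
        by (simp only: distrib_left) (meson add_left_mono mult_le_mono1 order.trans)
    qed
    also have "\<dots> = (\<Sum>j\<in>{i<..n}. L ^ (n - j) * b j) + \<mu> * (\<Sum>j\<in>{i<..n}. \<alpha> j + m - b j)"
      by (simp add: sum.distrib sum_distrib_left)
    also have "(\<Sum>j\<in>{i<..n}. \<alpha> j + m - b j) \<le> n * m"
    proof -
      have "(\<Sum>j\<in>{i<..n}. \<alpha> j + m - b j) + (\<Sum>j\<in>{i<..n}. b j) = (\<Sum>j\<in>{i<..n}. \<alpha> j + m)"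
        unfolding sum.distrib[symmetric] using after by (intro sum.cong) auto
      also have "\<dots> = (\<Sum>j\<in>{i<..n}. \<alpha> j) + (n - i) * m" by (simp add: sum.distrib)
      also have "(\<Sum>j\<in>{i<..n}. \<alpha> j) = (\<Sum>j\<in>{i<..n}. b j) + \<delta>"
        using sums \<delta>(1) by (simp add: split)
      finally have "(\<Sum>j\<in>{i<..n}. \<alpha> j + m - b j) = \<delta> + (n - i) * m" by simp
      also have "\<dots> \<le> (n - i + 1) * m" using \<delta>(2) by simp
      also have "\<dots> \<le> n * m" using \<open>i < n\<close> i by (intro mult_le_mono1) auto
      finally show ?thesis .
    qed
    finally show ?thesis by simp
  qed
  have "\<mu> * (n * m) + Suc m \<le> L ^ (n - i) * \<delta>"
  proof -
    have "\<mu> * (n * m) + Suc m \<le> \<mu> * (n * Suc m) + \<mu> * Suc m"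
      using mult_le_mono1[OF \<open>\<mu> \<ge> 1\<close>, of "Suc m"] by (intro add_mono mult_le_mono2) simp_all
    also have "\<dots> = \<mu> * ((n + 1) * Suc m)" by (simp add: algebra_simps)
    also have "\<dots> \<le> \<mu> * ((n + 1) * (4 * \<delta>))" using \<delta>(3) by (intro mult_le_mono2) simp
    also have "\<dots> \<le> \<mu> * (L * \<delta>)"
    proof -
      have "(n + 1) * 4 \<le> L" using L by simp
      thus ?thesis by (metis mult.assoc mult_le_mono1 mult_le_mono2)
    qed
    finally show ?thesis by (simp add: \<kappa>i mult_ac)
  qed
  moreover have "(\<Sum>j=2..<i. L ^ (n - j) * \<alpha> j) = (\<Sum>j=2..<i. L ^ (n - j) * b j)"
    using before by (intro sum.cong) auto
  ultimately show ?thesis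
    unfolding split2 using tail by (simp add: \<delta>(1) distrib_left)
qed

section \<open>Explicit constants\<close>

definition interp_const :: "nat \<Rightarrow> real" where
  "interp_const n = 2 * 24 ^ (n + 1)"

definition weight_const :: "nat \<Rightarrow> real" where
  "weight_const n = 2 * (48 * real n) ^ (n + 1) * interp_const n ^ n"

text \<open>Loss per unit of scale: \<open>n\<close> for the descent to a layer, a power of
  \<open>weight_const\<close> for passing to the penalized maximum, and a power of
  \<open>interp_const\<close> for the interpolations. The base \<open>8 * (n + 2)\<close> is the
  ratio of successive weights.\<close>

definition loss :: "nat \<Rightarrow> real" where
  "loss n = real n * weight_const n ^ ((8 * (n + 2)) ^ n * n) * interp_const n ^ (n * n)"

text \<open>Product of \<open>2 ^ n\<close>, from \<open>separated_block\<close>, and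
  \<open>2 * (n + 2)\<close>, from comparing \<open>2 * ((n + 1) * m + t)\<close> with
  \<open>Suc m\<close>.\<close>

definition spread :: "nat \<Rightarrow> nat" where
  "spread n = 2 ^ (n + 1) * (n + 2)"

lemma interp_const_ge_1: "interp_const n \<ge> 1"
  using one_le_power[of "24::real" "n + 1"] unfolding interp_const_def by linarith

lemma weight_const_ge_1: "n \<ge> 1 \<Longrightarrow> weight_const n \<ge> 1"
proof -
  assume "n \<ge> 1"
  hence "(1::real) \<le> (48 * real n) ^ (n + 1)" by (intro one_le_power) auto
  moreover have "1 \<le> interp_const n ^ n" by (intro one_le_power interp_const_ge_1)
  ultimately have "1 * 1 * 1 \<le> 2 * (48 * real n) ^ (n + 1) * interp_const n ^ n"
    by (intro mult_mono) auto
  thus ?thesis by (simp add: weight_const_def)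
qed

lemma loss_ge_1: "n \<ge> 1 \<Longrightarrow> loss n \<ge> 1"
proof -
  assume n: "n \<ge> 1"
  have "1 * 1 * 1 \<le> loss n" unfolding loss_def
    using n weight_const_ge_1[OF n] interp_const_ge_1[of n]
    by (intro mult_mono one_le_power) auto
  thus ?thesis by simp
qed

lemma simplex_sum: "\<alpha> \<in> simplex_lattice n N \<Longrightarrow> (\<Sum>j=1..n. \<alpha> j) = N"
  by (simp add: simplex_lattice_def)

text \<open>Both points have the same coordinate sum, so a gain in coordinate \<open>j\<close> is
  paid for by losses of at most \<open>m\<close> in each of the others.\<close>

lemma simplex_le_of_lower_bounds:
  assumes "\<alpha> \<in> simplex_lattice n N" "b \<in> simplex_lattice n N"
    and low: "\<And>j. j \<in> {1..n} \<Longrightarrow> b j \<le> \<alpha> j + m" and j: "j \<in> {1..n}"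
  shows "\<alpha> j \<le> b j + n * m"
proof -
  have *: "(\<Sum>k=1..n. f k) = f j + (\<Sum>k\<in>{1..n} - {j}. f k)" for f :: "nat \<Rightarrow> nat"
    using j by (intro sum.remove) auto
  have "(\<Sum>k\<in>{1..n} - {j}. b k) \<le> (\<Sum>k\<in>{1..n} - {j}. \<alpha> k + m)"
    using low by (intro sum_mono) auto
  also have "\<dots> \<le> (\<Sum>k\<in>{1..n} - {j}. \<alpha> k) + n * m"
    using j by (simp add: sum.distrib)
  finally show ?thesis
    using simplex_sum[OF assms(1)] simplex_sum[OF assms(2)] unfolding * by linarith
qed

text \<open>The work at one corner \<open>x\<close>: maximality of \<open>b\<close> provides the
  decay through \<open>weight_drop\<close>, and \<open>separated_block\<close> provides the points.
  The count is stated against \<open>2 * ((n + 1) * m + t)\<close> because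
  \<open>greedy_disjoint_boxes\<close> charges a power of this to the corner, so that corners with
  different \<open>m\<close> can be summed.\<close>

lemma local_block:
  assumes n: "n \<ge> 2" and N: "N \<ge> 1" and harm: "harmonic n N g" and p: "p \<in> simplex_lattice n N"
    and q: "2 * q + 1 \<le> n" and t: "t \<ge> 1"
    and x: "\<And>j. x j \<le> p j" "\<And>j. p j \<le> x j + T"
  shows "\<exists>J m P. J \<subseteq> {2..2*q+1} \<and> card J = q \<and> finite P \<and> P \<noteq> {} \<and> separated t P \<and>
    (2 * ((n + 1) * m + t)) ^ Suc q \<le> (spread n * t) ^ Suc q * card P \<and>
    (\<forall>\<alpha>\<in>P. \<alpha> \<in> simplex_lattice n N \<and> (\<forall>j. x j \<le> \<alpha> j) \<and>
       (\<forall>j\<in>insert 1 J. \<alpha> j \<le> x j + (n + 1) * m) \<and> \<bar>g p\<bar> \<le> loss n ^ Suc T * \<bar>g \<alpha>\<bar>)"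
proof -
  define Q where "Q = interp_const n"
  define B where "B = weight_const n"
  define L where "L = 8 * (n + 2)"
  define wt where "wt \<alpha> = (\<Sum>j=2..n. L ^ (n - j) * \<alpha> j)" for \<alpha> :: "nat \<Rightarrow> nat"
  define S where "S = {\<alpha>\<in>simplex_lattice n N. \<alpha> 1 = x 1 \<and> (\<forall>j. x j \<le> \<alpha> j)}"
  have B1: "B \<ge> 1" using n by (simp add: B_def weight_const_ge_1)
  have Q1: "Q \<ge> 1" by (simp add: Q_def interp_const_ge_1)
  have finS: "finite S" using finite_simplex_lattice by (simp add: S_def)
  \<comment> \<open>Descending in direction 1 to the layer of \<open>x\<close> shows that
    \<open>S\<close> contains a point at which \<open>g\<close> is not much smaller than at
    \<open>p\<close>.\<close>
  obtain c where c: "c \<in> simplex_lattice n N" "c 1 = p 1 - (p 1 - x 1)" "\<And>k. k \<noteq> 1 \<Longrightarrow> p k \<le> c k"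
    "\<bar>g p\<bar> \<le> real n ^ (p 1 - x 1) * \<bar>g c\<bar>"
    using cone_property[OF harm p, of 1 "p 1 - x 1"] n by auto
  have cS: "c \<in> S"
    using c x by (auto simp: S_def) (metis diff_diff_cancel order.trans order_refl)
  have "real n ^ (p 1 - x 1) \<le> real n ^ T" using x(2)[of 1] n by (intro power_increasing) auto
  hence gpc: "\<bar>g p\<bar> \<le> real n ^ T * \<bar>g c\<bar>"
    using c(4) by (meson abs_ge_zero mult_right_mono order.trans)
  define f where "f \<alpha> = \<bar>g \<alpha>\<bar> / B ^ wt \<alpha>" for \<alpha>
  have "Max (f ` S) \<in> f ` S" using finS cS by (intro Max_in) auto
  then obtain b where b: "b \<in> S" "f b = Max (f ` S)" by auto
  have fb: "\<bar>g \<alpha>\<bar> * B ^ wt b \<le> \<bar>g b\<bar> * B ^ wt \<alpha>" if "\<alpha> \<in> S" for \<alpha>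
  proof -
    have "f \<alpha> \<le> f b" unfolding b(2) using that finS by (intro Max_ge) auto
    thus ?thesis using B1 by (simp add: f_def field_simps)
  qed
  have bS: "b \<in> simplex_lattice n N" "b 1 = x 1" "\<And>j. x j \<le> b j"
    using b(1) by (auto simp: S_def)
  have excess: "(\<Sum>j=1..n. \<alpha> j - x j) \<le> n * T" if "\<alpha> \<in> S" for \<alpha>
  proof -
    have "(\<Sum>j=1..n. \<alpha> j - x j) + (\<Sum>j=1..n. x j) = (\<Sum>j=1..n. \<alpha> j)"
      unfolding sum.distrib[symmetric] using that by (intro sum.cong) (auto simp: S_def)
    also have "\<dots> = (\<Sum>j=1..n. p j)" using that simplex_sum[of \<alpha> n N] simplex_sum[OF p]
      by (simp only: S_def mem_Collect_eq)
    also have "\<dots> \<le> (\<Sum>j=1..n. x j + T)" using x by (intro sum_mono) auto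
    finally show ?thesis by (simp add: sum.distrib)
  qed
  have gcb: "\<bar>g c\<bar> \<le> B ^ (L ^ n * (n * T)) * \<bar>g b\<bar>"
  proof -
    have "wt c \<le> (\<Sum>j=2..n. L ^ (n - j) * x j + L ^ n * (c j - x j))"
      unfolding wt_def
    proof (rule sum_mono)
      fix j assume "j \<in> {2..n}"
      have "L ^ (n - j) \<le> L ^ n" by (intro power_increasing) (auto simp: L_def)
      moreover have "c j = x j + (c j - x j)" using cS by (simp add: S_def)
      ultimately show "L ^ (n - j) * c j \<le> L ^ (n - j) * x j + L ^ n * (c j - x j)"
        by (metis add_left_mono distrib_left mult_le_mono1)
    qed
    also have "\<dots> = wt x + L ^ n * (\<Sum>j=2..n. c j - x j)"
      by (simp add: wt_def sum.distrib sum_distrib_left)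
    also have "(\<Sum>j=2..n. c j - x j) \<le> (\<Sum>j=1..n. c j - x j)" by (intro sum_mono2) auto
    also have "\<dots> \<le> n * T" by (rule excess[OF cS])
    finally have lc: "wt c \<le> wt x + L ^ n * (n * T)" by simp
    have "wt x \<le> wt b" unfolding wt_def using bS by (intro sum_mono mult_le_mono2) auto
    hence "\<bar>g c\<bar> * B ^ wt x \<le> \<bar>g c\<bar> * B ^ wt b"
      using B1 by (intro mult_left_mono power_increasing) auto
    also have "\<dots> \<le> \<bar>g b\<bar> * B ^ wt c" by (rule fb[OF cS])
    also have "\<dots> \<le> \<bar>g b\<bar> * B ^ (wt x + L ^ n * (n * T))"
      using B1 lc by (intro mult_left_mono power_increasing) auto
    also have "\<dots> = (B ^ (L ^ n * (n * T)) * \<bar>g b\<bar>) * B ^ wt x" by (simp add: power_add)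
    finally show ?thesis using B1 by simp
  qed
  \<comment> \<open>For \<open>q = 0\<close> there are no directions to rank; with
    \<open>m = 0\<close> one point is then enough.\<close>
  have "\<exists>m J H. J \<subseteq> {2..2*q+1} \<and> H \<subseteq> {2..2*q+1} \<and> card J = q \<and> (card H = Suc q \<or> q = 0 \<and> m = 0 \<and> H = {}) \<and>
    (\<forall>j\<in>J. b j - x j \<le> m) \<and> (\<forall>j\<in>H. m \<le> b j - x j)"
  proof (cases "q = 0")
    case False
    thus ?thesis using split_at_rank[of "{2..2*q+1}" q "\<lambda>j. b j - x j"] by auto
  qed (intro exI[of _ 0] exI[of _ "{}"], auto)
  then obtain m J H where J: "J \<subseteq> {2..2*q+1}" "card J = q" "\<And>j. j \<in> J \<Longrightarrow> b j - x j \<le> m"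
    and H: "H \<subseteq> {2..2*q+1}" "card H = Suc q \<or> q = 0 \<and> m = 0 \<and> H = {}"
      "\<And>j. j \<in> H \<Longrightarrow> m \<le> b j - x j" by blast
  have mT: "m \<le> n * T"
  proof (cases "H = {}")
    case True
    thus ?thesis using H(2) by auto
  next
    case False
    then obtain j where j: "j \<in> H" by blast
    have "m \<le> b j - x j" using H(3)[OF j] .
    also have "\<dots> \<le> (\<Sum>j=1..n. b j - x j)" using j H(1) q by (intro member_le_sum) auto
    also have "\<dots> \<le> n * T" by (rule excess[OF b(1)])
    finally show ?thesis .
  qed
  define low where "low j = (if j \<in> H then m else 0)" for j
  have lowx: "x j \<le> \<alpha> j" if "\<alpha> \<in> simplex_lattice n N" "b 1 \<le> \<alpha> 1"
    "\<And>j. j \<in> {2..n} \<Longrightarrow> b j \<le> \<alpha> j + low j" for \<alpha> j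
  proof -
    consider "j = 1" | "j \<in> {2..n}" | "j \<notin> {1..n}" by force
    thus ?thesis
    proof cases
      case 1
      thus ?thesis using that bS by simp
    next
      case 2
      show ?thesis using that(3)[OF 2] H(3)[of j] bS(3)[of j] by (auto simp: low_def split: if_splits)
    next
      case 3
      hence "p j = 0" using p by (auto simp: simplex_lattice_def)
      thus ?thesis using x(1)[of j] by simp
    qed
  qed
  have lowm: "low j \<le> m" for j by (simp add: low_def)
  interpret dp: decaying_point n N m g b H Q B low
  proof unfold_locales
    show "low \<equiv> \<lambda>j. if j \<in> H then m else 0"
      by (rule eq_reflection) (simp add: low_def fun_eq_iff)
    show "H \<subseteq> {2..n}" using H(1) q by auto
    show "m \<le> b j" if "j \<in> H" for j using H(3)[OF that] by simp
    show "2 * (48 * real n) ^ (n + 1) * Q ^ n \<le> B" by (simp add: B_def Q_def weight_const_def)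
    fix i \<alpha> assume i: "i \<in> H" and \<alpha>: "\<alpha> \<in> simplex_lattice n N" "\<alpha> 1 = b 1"
      "\<And>j. j \<in> {2..<i} \<Longrightarrow> \<alpha> j = b j" "\<And>j. j \<in> {2..n} \<Longrightarrow> b j \<le> \<alpha> j + (if j \<in> H then m else 0)"
      "\<alpha> i + m div 4 < b i"
    have \<alpha>': "b j \<le> \<alpha> j + low j" if "j \<in> {2..n}" for j using \<alpha>(4)[OF that] by (simp add: low_def)
    have i2: "i \<in> {2..n}" using i H(1) q by auto
    have \<alpha>S: "\<alpha> \<in> S" using \<alpha> \<alpha>' lowx[of \<alpha>] bS(2) by (auto simp: S_def)
    have "wt \<alpha> + Suc m \<le> wt b"
      unfolding wt_def
    proof (rule weight_drop[OF i2])
      show "b i \<le> \<alpha> i + m" using \<alpha>'[OF i2] lowm[of i] by simp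
      show "b j \<le> \<alpha> j + m" if "j \<in> {i<..n}" for j
        using \<alpha>'[of j] lowm[of j] that i2 by simp
      have split: "(\<Sum>j=1..n. f j) = (\<Sum>j=1..<i. f j) + (\<Sum>j=i..n. f j)" for f :: "nat \<Rightarrow> nat"
      proof -
        have "{1..n} = {1..<i} \<union> {i..n}" using i2 by auto
        thus ?thesis by (simp only:) (rule sum.union_disjoint, auto)
      qed
      have "(\<Sum>j=1..<i. \<alpha> j) = (\<Sum>j=1..<i. b j)"
        using \<alpha>(2,3) by (intro sum.cong refl) (metis atLeastLessThan_iff le_neq_implies_less Suc_1 Suc_leI One_nat_def)
      thus "(\<Sum>j=i..n. \<alpha> j) = (\<Sum>j=i..n. b j)"
        using simplex_sum[OF \<alpha>(1)] simplex_sum[OF bS(1)] split[of \<alpha>] split[of b] by linarith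
    qed (use \<alpha> in \<open>auto simp: L_def\<close>)
    hence "\<bar>g \<alpha>\<bar> * B ^ (wt \<alpha> + Suc m) \<le> \<bar>g \<alpha>\<bar> * B ^ wt b"
      using B1 by (intro mult_left_mono power_increasing) auto
    also have "\<dots> \<le> \<bar>g b\<bar> * B ^ wt \<alpha>" by (rule fb[OF \<alpha>S])
    finally have "(B ^ Suc m * \<bar>g \<alpha>\<bar>) * B ^ wt \<alpha> \<le> \<bar>g b\<bar> * B ^ wt \<alpha>"
      by (simp only: power_add mult_ac)
    thus "B ^ Suc m * \<bar>g \<alpha>\<bar> \<le> \<bar>g b\<bar>" using B1 by simp
  qed (use n N harm bS in \<open>simp_all add: Q_def interp_const_def\<close>)
  obtain P where P: "finite P" "P \<noteq> {}" "separated t P"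
    "Suc m ^ card H \<le> (2 ^ n * t) ^ card H * card P"
    "\<And>\<alpha>. \<alpha> \<in> P \<Longrightarrow> \<alpha> \<in> simplex_lattice n N" "\<And>\<alpha>. \<alpha> \<in> P \<Longrightarrow> b 1 \<le> \<alpha> 1"
    "\<And>\<alpha> j. \<alpha> \<in> P \<Longrightarrow> j \<in> {2..n} \<Longrightarrow> b j \<le> \<alpha> j + low j"
    "\<And>\<alpha>. \<alpha> \<in> P \<Longrightarrow> \<bar>g b\<bar> \<le> Q ^ (n * Suc m) * \<bar>g \<alpha>\<bar>"
    using dp.separated_block[OF t] by blast
  have count: "(2 * ((n + 1) * m + t)) ^ Suc q \<le> (spread n * t) ^ Suc q * card P"
  proof -
    have P1: "card P \<ge> 1" using P(1,2) by (simp add: Suc_le_eq card_gt_0_iff)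
    show ?thesis
    \<comment> \<open>For \<open>m \<le> t\<close> a single point of \<open>P\<close> suffices.
      Otherwise \<open>m > 0\<close> rules out the degenerate choice, so \<open>H\<close> has
      \<open>q + 1\<close> elements, and \<open>t < m\<close> bounds the side by a multiple of
      \<open>Suc m\<close>.\<close>
    proof (cases "m \<le> t")
      case True
      have "2 * ((n + 1) * m + t) \<le> 2 * ((n + 1) * t + t)"
        using True by (intro mult_le_mono2 add_mono) auto
      also have "\<dots> = 2 * ((n + 2) * t)" by simp
      also have "\<dots> \<le> 2 ^ (n + 1) * ((n + 2) * t)" by (intro mult_le_mono1) simp
      also have "\<dots> = spread n * t" by (simp only: spread_def mult.assoc)
      finally have "2 * ((n + 1) * m + t) \<le> spread n * t" .
      hence "(2 * ((n + 1) * m + t)) ^ Suc q \<le> (spread n * t) ^ Suc q" by (rule power_mono) simp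
      hence "(2 * ((n + 1) * m + t)) ^ Suc q * 1 \<le> (spread n * t) ^ Suc q * card P"
        using P1 by (rule mult_le_mono)
      thus ?thesis by simp
    next
      case False
      hence H': "card H = Suc q" using H(2) by auto
      have "2 * ((n + 1) * m + t) \<le> 2 * ((n + 1) * Suc m + Suc m)"
        using False by (intro mult_le_mono2 add_mono) auto
      also have "\<dots> = (2 * (n + 2)) * Suc m" by simp
      finally have "(2 * ((n + 1) * m + t)) ^ Suc q \<le> ((2 * (n + 2)) * Suc m) ^ Suc q"
        by (rule power_mono) simp
      also have "\<dots> = (2 * (n + 2)) ^ Suc q * Suc m ^ Suc q" by (rule power_mult_distrib)
      also have "\<dots> \<le> (2 * (n + 2)) ^ Suc q * ((2 ^ n * t) ^ Suc q * card P)"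
        using P(4) unfolding H' by (rule mult_le_mono2)
      also have "\<dots> = ((2 * (n + 2)) * (2 ^ n * t)) ^ Suc q * card P"
        by (simp only: power_mult_distrib[of _ _ "Suc q"] mult.assoc)
      also have "(2 * (n + 2)) * (2 ^ n * t) = spread n * t"
        by (simp only: spread_def power_add power_one_right mult_ac)
      finally show ?thesis .
    qed
  qed
  have size: "\<bar>g p\<bar> \<le> loss n ^ Suc T * \<bar>g \<alpha>\<bar>" if \<alpha>: "\<alpha> \<in> P" for \<alpha>
  proof -
    have "\<bar>g p\<bar> \<le> real n ^ T * (B ^ (L ^ n * (n * T)) * (Q ^ (n * Suc m) * \<bar>g \<alpha>\<bar>))"
      using B1
      by (intro order.trans[OF gpc] mult_left_mono order.trans[OF gcb] P(8)[OF \<alpha>]) auto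
    also have "\<dots> \<le> real n ^ Suc T * (B ^ (L ^ n * n * Suc T) * (Q ^ (n * n * Suc T) * \<bar>g \<alpha>\<bar>))"
    proof -
      have "n * Suc m \<le> n * n * Suc T"
      proof -
        have "Suc m \<le> n * Suc T" using mT n by simp
        thus ?thesis by (metis mult.assoc mult_le_mono2)
      qed
      hence "Q ^ (n * Suc m) \<le> Q ^ (n * n * Suc T)" using Q1 by (rule power_increasing)
      moreover have "B ^ (L ^ n * (n * T)) \<le> B ^ (L ^ n * n * Suc T)"
        using B1 by (intro power_increasing) (simp_all add: mult.assoc)
      moreover have "real n ^ T \<le> real n ^ Suc T" using n by (intro power_increasing) auto
      ultimately show ?thesis using B1 Q1 by (intro mult_mono) auto
    qed
    also have "\<dots> = loss n ^ Suc T * \<bar>g \<alpha>\<bar>"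
      unfolding loss_def B_def[symmetric] Q_def[symmetric] L_def[symmetric]
        power_mult[of B "L ^ n * n" "Suc T"] power_mult[of Q "n * n" "Suc T"]
      by (simp only: power_mult_distrib[of _ _ "Suc T"] mult.assoc)
    finally show ?thesis .
  qed
  have up: "\<alpha> j \<le> x j + (n + 1) * m" if \<alpha>: "\<alpha> \<in> P" and j: "j \<in> insert 1 J" for \<alpha> j
  proof -
    have j1: "j \<in> {1..n}" using j J(1) q n by auto
    have "b k \<le> \<alpha> k + m" if "k \<in> {1..n}" for k
    proof (cases "k = 1")
      case True
      thus ?thesis using P(6)[OF \<alpha>] by simp
    next
      case False
      thus ?thesis using P(7)[OF \<alpha>, of k] lowm[of k] that by simp
    qed
    hence "\<alpha> j \<le> b j + n * m" by (rule simplex_le_of_lower_bounds[OF P(5)[OF \<alpha>] bS(1) _ j1])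
    moreover have "b j \<le> x j + m" using j J(3)[of j] bS(2) by auto
    ultimately show ?thesis by simp
  qed
  have "x j \<le> \<alpha> j" if "\<alpha> \<in> P" for \<alpha> j
    by (rule lowx[OF P(5)[OF that] P(6)[OF that] P(7)[OF that]])
  hence "\<forall>\<alpha>\<in>P. \<alpha> \<in> simplex_lattice n N \<and> (\<forall>j. x j \<le> \<alpha> j) \<and>
      (\<forall>j\<in>insert 1 J. \<alpha> j \<le> x j + (n + 1) * m) \<and> \<bar>g p\<bar> \<le> loss n ^ Suc T * \<bar>g \<alpha>\<bar>"
    by (intro ballI conjI allI P(5) size up)
  thus ?thesis
    using J(1,2) P(1-3) count by (intro exI[of _ J] exI[of _ m] exI[of _ P] conjI)
qed

text \<open>By pigeonhole the set \<open>J\<close> and the coordinates outside \<open>insert 1 J\<close> may be fixed; disjointness of the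
  boxes is then decided in the \<open>q + 1\<close> coordinates in which the points stay near their corner.\<close>

lemma separated_family:
  assumes n: "n \<ge> 2" and N: "N \<ge> 1" and harm: "harmonic n N g" and p: "p \<in> simplex_lattice n N"
    and q: "2 * q + 1 \<le> n" and t: "t \<ge> 1" and T: "\<And>i. i \<in> {1..2*q+1} \<Longrightarrow> T \<le> p i"
  shows "\<exists>P. finite P \<and> separated t P \<and> Suc T ^ Suc q \<le> (4 * spread n * t) ^ Suc q * card P \<and>
    (\<forall>\<alpha>\<in>P. \<alpha> \<in> simplex_lattice n N \<and> \<bar>g p\<bar> \<le> loss n ^ Suc T * \<bar>g \<alpha>\<bar> \<and>
       (\<forall>j. p j \<le> \<alpha> j + (if j \<in> {1..2*q+1} then T else 0)))"
proof -
  \<comment> \<open>The corners \<open>x u\<close> with \<open>u\<close> in \<open>U\<close> fill a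
    cube of side \<open>T\<close> below \<open>p\<close> in the first \<open>2 * q + 1\<close>
    directions.\<close>
  define U where "U = PiE {1..2*q+1} (\<lambda>_. {..T})"
  define x where "x u j = p j - (if j \<in> {1..2*q+1} then u j else 0)" for u j
  define good where "good u J m P \<longleftrightarrow> J \<subseteq> {2..2*q+1} \<and> card J = q \<and> finite P \<and> P \<noteq> {} \<and>
    separated t P \<and> (2 * ((n + 1) * m + t)) ^ Suc q \<le> (spread n * t) ^ Suc q * card P \<and>
    (\<forall>\<alpha>\<in>P. \<alpha> \<in> simplex_lattice n N \<and> (\<forall>j. x u j \<le> \<alpha> j) \<and>
       (\<forall>j\<in>insert 1 J. \<alpha> j \<le> x u j + (n + 1) * m) \<and> \<bar>g p\<bar> \<le> loss n ^ Suc T * \<bar>g \<alpha>\<bar>)"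
    for u J m P
  have uT: "u j \<le> T" if "u \<in> U" "j \<in> {1..2*q+1}" for u j
    using PiE_mem[of u "{1..2*q+1}" "\<lambda>_. {..T}" j] that by (simp add: U_def)
  have "\<exists>J m P. good u J m P" if u: "u \<in> U" for u
    unfolding good_def
  proof (rule local_block[OF n N harm p q t])
    show "x u j \<le> p j" for j by (simp add: x_def)
    show "p j \<le> x u j + T" for j using uT[OF u, of j] by (auto simp: x_def)
  qed
  then obtain J m P where good: "\<And>u. u \<in> U \<Longrightarrow> good u (J u) (m u) (P u)" by metis
  have finU: "finite U" unfolding U_def by (intro finite_PiE) auto
  have cardU: "card U = Suc T ^ (2*q+1)" by (simp add: U_def card_PiE)
  \<comment> \<open>The data fixed by the pigeonhole: the set \<open>J u\<close> and the coordinates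
    of \<open>u\<close> outside \<open>insert 1 (J u)\<close>.\<close>
  define V where "V = (SIGMA I:{I. I \<subseteq> {2..2*q+1} \<and> card I = q}. PiE ({2..2*q+1} - I) (\<lambda>_. {..T}))"
  have finI: "finite {I. I \<subseteq> {2..2*q+1} \<and> card I = q}"
    by (rule finite_subset[of _ "Pow {2..2*q+1}"]) auto
  have finV: "finite V" unfolding V_def using finI by (intro finite_SigmaI finite_PiE) auto
  have cardV: "card V \<le> 4 ^ q * Suc T ^ q"
  proof -
    have "card V = (\<Sum>I\<in>{I. I \<subseteq> {2..2*q+1} \<and> card I = q}. card (PiE ({2..2*q+1} - I) (\<lambda>_. {..T})))"
      unfolding V_def using finI by (intro card_SigmaI) (auto intro!: finite_PiE)
    also have "\<dots> = (\<Sum>I\<in>{I. I \<subseteq> {2..2*q+1} \<and> card I = q}. Suc T ^ q)"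
    proof (rule sum.cong)
      fix I assume "I \<in> {I. I \<subseteq> {2..2*q+1} \<and> card I = q}"
      hence "card ({2..2*q+1} - I) = q" by (subst card_Diff_subset) (auto intro: finite_subset)
      thus "card (PiE ({2..2*q+1} - I) (\<lambda>_. {..T})) = Suc T ^ q" by (simp add: card_PiE)
    qed simp
    also have "\<dots> = card {I. I \<subseteq> {2..2*q+1} \<and> card I = q} * Suc T ^ q" by simp
    also have "\<dots> \<le> card (Pow {2..2*q+1}) * Suc T ^ q" by (intro mult_le_mono1 card_mono) auto
    also have "\<dots> = 4 ^ q * Suc T ^ q" by (simp add: card_Pow power_mult)
    finally show ?thesis .
  qed
  define \<phi> where "\<phi> u = (J u, restrict u ({2..2*q+1} - J u))" for u
  have \<phi>: "\<phi> \<in> U \<rightarrow> V"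
    using good uT by (auto simp: \<phi>_def V_def good_def)
  have "(\<lambda>j\<in>{1..2*q+1}. 0) \<in> U" by (simp add: U_def)
  hence "V \<noteq> {}" using \<phi> by blast
  from pigeonhole_card[OF \<phi> finU finV this] obtain v
    where v: "card U \<le> card (\<phi> -` {v} \<inter> U) * card V" by blast
  define X where "X = \<phi> -` {v} \<inter> U"
  define I where "I = insert 1 (fst v)"
  have XU: "X \<subseteq> U" "finite X" using finU by (auto simp: X_def)
  have JX: "J u = fst v" if "u \<in> X" for u using that by (auto simp: X_def \<phi>_def)
  \<comment> \<open>\<open>U\<close> is split into at most \<open>4 ^ q * Suc T ^ q\<close> classes;
    cancelling \<open>Suc T ^ q\<close> leaves a lower bound for the chosen class
    \<open>X\<close>.\<close>
  have "Suc T ^ q * Suc T ^ Suc q = Suc T ^ (2*q+1)"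
    by (subst power_add[symmetric]) (rule arg_cong[of _ _ "(^) (Suc T)"], simp)
  also have "\<dots> \<le> card X * (4 ^ q * Suc T ^ q)"
    using v cardV unfolding cardU X_def[symmetric] by (meson le_trans mult_le_mono2)
  also have "\<dots> = Suc T ^ q * (4 ^ q * card X)" by (simp add: mult_ac)
  finally have cardX: "Suc T ^ Suc q \<le> 4 ^ q * card X" by simp
  hence "X \<noteq> {}" by auto
  then obtain u0 where u0: "u0 \<in> X" by blast
  have I1: "fst v \<subseteq> {2..2*q+1}" "card (fst v) = q"
    using good[of u0] JX[OF u0] u0 XU(1) by (auto simp: good_def)
  have finI0: "finite (fst v)" using I1(1) finite_subset by blast
  have cardI: "card I = Suc q"
  proof -
    have "1 \<notin> fst v" using I1(1) by auto
    thus ?thesis unfolding I_def using finI0 I1(2) by simp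
  qed
  \<comment> \<open>In the directions of \<open>I\<close> the points of \<open>P u\<close> lie at
    most \<open>(n + 1) * m u\<close> above their corner; the additional \<open>t\<close> puts
    points of disjoint boxes \<open>t\<close> apart.\<close>
  define R where "R u = (n + 1) * m u + t" for u
  have "\<exists>Y\<subseteq>X. (\<forall>u\<in>Y. \<forall>w\<in>Y. u \<noteq> w \<longrightarrow> (\<exists>j\<in>I. x u j + R u \<le> x w j \<or> x w j + R w \<le> x u j)) \<and>
    card X \<le> (\<Sum>u\<in>Y. (2 * R u) ^ card I)"
  proof (rule greedy_disjoint_boxes[OF XU(2)])
    show "finite I" using finI0 by (simp add: I_def)
    show "1 \<le> R u" for u using t by (simp add: R_def)
    fix u w assume uw: "u \<in> X" "w \<in> X" and eq: "\<And>j. j \<in> I \<Longrightarrow> x u j = x w j"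
    have uwU: "u \<in> U" "w \<in> U" using uw XU by auto
    have "restrict u ({2..2*q+1} - fst v) = restrict w ({2..2*q+1} - fst v)"
    proof -
      have "\<phi> u = \<phi> w" using uw by (simp add: X_def)
      thus ?thesis by (simp add: \<phi>_def JX[OF uw(1)] JX[OF uw(2)])
    qed
    hence off: "u j = w j" if "j \<in> {2..2*q+1} - fst v" for j using that by (metis restrict_apply')
    show "u = w"
    proof (rule PiE_ext[of u "{1..2*q+1}" "\<lambda>_. {..T}" w])
      fix j assume j: "j \<in> {1..2*q+1}"
      show "u j = w j"
      proof (cases "j \<in> I")
        case True
        \<comment> \<open>By \<open>T \<le> p j\<close> neither subtraction is truncated, so
          \<open>u j\<close> can be recovered.\<close>
        have "p j - u j = p j - w j" using eq[OF True] j by (simp add: x_def)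
        thus ?thesis using uT[OF uwU(1) j] uT[OF uwU(2) j] T[OF j] by linarith
      next
        case False
        thus ?thesis using j by (intro off) (auto simp: I_def)
      qed
    qed (use uwU in \<open>auto simp: U_def\<close>)
  qed
  then obtain Y where Y: "Y \<subseteq> X"
    "\<And>u w. u \<in> Y \<Longrightarrow> w \<in> Y \<Longrightarrow> u \<noteq> w \<Longrightarrow> \<exists>j\<in>I. x u j + R u \<le> x w j \<or> x w j + R w \<le> x u j"
    "card X \<le> (\<Sum>u\<in>Y. (2 * R u) ^ card I)" by blast
  have finY: "finite Y" using Y(1) XU(2) by (rule finite_subset)
  have goodY: "good u (fst v) (m u) (P u)" if "u \<in> Y" for u
    using good[of u] JX[of u] that Y(1) XU(1) by (metis subsetD)
  have in_box: "x u j \<le> \<alpha> j \<and> \<alpha> j \<le> x u j + (n + 1) * m u" if "u \<in> Y" "\<alpha> \<in> P u" "j \<in> I" for u \<alpha> j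
    using goodY[OF that(1)] that(2,3) unfolding good_def I_def by blast
  have ap: "apart t \<alpha> \<beta>" if uw: "u \<in> Y" "w \<in> Y" "u \<noteq> w" "\<alpha> \<in> P u" "\<beta> \<in> P w" for u w \<alpha> \<beta>
  proof -
    obtain j where j: "j \<in> I" "x u j + R u \<le> x w j \<or> x w j + R w \<le> x u j" using Y(2) uw by blast
    have "\<alpha> j + t \<le> \<beta> j \<or> \<beta> j + t \<le> \<alpha> j"
      using j(2) in_box[OF uw(1,4) j(1)] in_box[OF uw(2,5) j(1)] unfolding R_def by linarith
    thus ?thesis unfolding apart_def by blast
  qed
  define Z where "Z = (\<Union>u\<in>Y. P u)"
  have fin: "finite (P u)" if "u \<in> Y" for u using goodY[OF that] by (simp add: good_def)
  have "separated t Z" unfolding Z_def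
    using goodY ap by (intro separated_UN) (auto simp: good_def)
  moreover have "finite Z" unfolding Z_def using fin finY by blast
  moreover have "Suc T ^ Suc q \<le> (4 * spread n * t) ^ Suc q * card Z"
  proof -
    have "card X \<le> (\<Sum>u\<in>Y. (spread n * t) ^ Suc q * card (P u))"
      using Y(3) goodY unfolding cardI R_def good_def by (elim order.trans) (intro sum_mono, blast)
    also have "\<dots> = (spread n * t) ^ Suc q * card Z"
      unfolding Z_def using card_UN_apart[OF finY t fin ap] by (simp add: sum_distrib_left)
    finally have "4 ^ q * card X \<le> 4 ^ Suc q * ((spread n * t) ^ Suc q * card Z)"
      by (intro mult_le_mono) auto
    also have "\<dots> = (4 * spread n * t) ^ Suc q * card Z"
      by (simp only: power_mult_distrib mult.assoc)
    finally show ?thesis using cardX by linarith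
  qed
  moreover have "\<forall>\<alpha>\<in>Z. \<alpha> \<in> simplex_lattice n N \<and> \<bar>g p\<bar> \<le> loss n ^ Suc T * \<bar>g \<alpha>\<bar> \<and>
       (\<forall>j. p j \<le> \<alpha> j + (if j \<in> {1..2*q+1} then T else 0))"
  proof
    fix \<alpha> assume "\<alpha> \<in> Z"
    then obtain u where u: "u \<in> Y" "\<alpha> \<in> P u" by (auto simp: Z_def)
    have \<alpha>: "\<alpha> \<in> simplex_lattice n N" "\<And>j. x u j \<le> \<alpha> j" "\<bar>g p\<bar> \<le> loss n ^ Suc T * \<bar>g \<alpha>\<bar>"
      using goodY[OF u(1)] u(2) unfolding good_def by blast+
    have "u \<in> U" using u(1) Y(1) XU(1) by blast
    have "p j \<le> \<alpha> j + (if j \<in> {1..2*q+1} then T else 0)" for j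
      using \<alpha>(2)[of j] uT[OF \<open>u \<in> U\<close>, of j] by (auto simp: x_def)
    thus "\<alpha> \<in> simplex_lattice n N \<and> \<bar>g p\<bar> \<le> loss n ^ Suc T * \<bar>g \<alpha>\<bar> \<and>
       (\<forall>j. p j \<le> \<alpha> j + (if j \<in> {1..2*q+1} then T else 0))" using \<alpha>(1,3) by blast
  qed
  ultimately show ?thesis by (intro exI[of _ Z]) blast
qed

section \<open>Iteration over scales\<close>

lemma antimono_from_steps:
  fixes a :: "nat \<Rightarrow> nat"
  assumes "\<And>i. i \<in> {1..<n} \<Longrightarrow> a (i + 1) \<le> a i" "1 \<le> i" "i \<le> j" "j \<le> n"
  shows "a j \<le> a i"
  using assms(3,4)
proof (induction rule: dec_induct)
  case (step k)
  thus ?case using assms(1)[of k] assms(2) by auto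
qed simp

text \<open>A round at scale \<open>\<tau> r\<close> raises a coordinate by at most
  \<open>n * \<tau> r\<close> and lowers it by at most \<open>\<tau> r\<close>, so descendants of
  points at distance \<open>s r = s (Suc r) + 2 * n * \<tau> r\<close> stay \<open>s (Suc r)\<close>
  apart. The division by \<open>n\<close> in \<open>\<tau>\<close> leaves every coordinate concerned
  enough room for all rounds.\<close>

lemma branching:
  fixes a :: "nat \<Rightarrow> nat"
  assumes n: "n \<ge> 2" and N: "N \<ge> 1" and harm: "harmonic n N g" and a: "a \<in> simplex_lattice n N"
    and dec: "\<And>i. i \<in> {1..<n} \<Longrightarrow> a (i + 1) \<le> a i"
  defines "\<tau> \<equiv> \<lambda>j. a (2 * j + 1) div n" and "q \<equiv> (n - 1) div 2"
  defines "s \<equiv> \<lambda>r. 1 + 2 * n * (\<Sum>j=r..q. \<tau> j)"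
  assumes r: "r \<le> Suc q"
  shows "\<exists>P. finite P \<and> separated (s r) P \<and>
    (\<Prod>j<r. Suc (\<tau> j) ^ Suc j) \<le> (\<Prod>j<r. (4 * spread n * s (Suc j)) ^ Suc j) * card P \<and>
    (\<forall>\<alpha>\<in>P. \<alpha> \<in> simplex_lattice n N \<and> \<bar>g a\<bar> \<le> loss n ^ (\<Sum>j<r. Suc (\<tau> j)) * \<bar>g \<alpha>\<bar> \<and>
       (\<forall>i\<in>{1..n}. a i \<le> \<alpha> i + r * (a i div n)))"
  using r
proof (induction r)
  case 0
  show ?case by (intro exI[of _ "{a}"]) (use a in \<open>auto simp: separated_def\<close>)
next
  case (Suc r)
  then obtain P where P: "finite P" "separated (s r) P"
    "(\<Prod>j<r. Suc (\<tau> j) ^ Suc j) \<le> (\<Prod>j<r. (4 * spread n * s (Suc j)) ^ Suc j) * card P"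
    "\<And>\<alpha>. \<alpha> \<in> P \<Longrightarrow> \<alpha> \<in> simplex_lattice n N"
    "\<And>\<alpha>. \<alpha> \<in> P \<Longrightarrow> \<bar>g a\<bar> \<le> loss n ^ (\<Sum>j<r. Suc (\<tau> j)) * \<bar>g \<alpha>\<bar>"
    "\<And>\<alpha> i. \<alpha> \<in> P \<Longrightarrow> i \<in> {1..n} \<Longrightarrow> a i \<le> \<alpha> i + r * (a i div n)" by fastforce
  have r: "r \<le> q" "2 * r + 1 \<le> n" "r < n" using Suc.prems n by (auto simp: q_def)
  have s_rec: "s r = s (Suc r) + 2 * n * \<tau> r"
    using r(1) by (simp add: s_def sum.atLeast_Suc_atMost algebra_simps)
  have s1: "s (Suc r) \<ge> 1" by (simp add: s_def)
  have \<tau>_le: "\<tau> r \<le> a i div n" if "i \<in> {1..2*r+1}" for i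
    unfolding \<tau>_def using that r(2) by (intro div_le_mono antimono_from_steps[of n a, OF dec]) auto
  define good where "good p Z \<longleftrightarrow> finite Z \<and> separated (s (Suc r)) Z \<and>
    Suc (\<tau> r) ^ Suc r \<le> (4 * spread n * s (Suc r)) ^ Suc r * card Z \<and>
    (\<forall>\<alpha>\<in>Z. \<alpha> \<in> simplex_lattice n N \<and> \<bar>g p\<bar> \<le> loss n ^ Suc (\<tau> r) * \<bar>g \<alpha>\<bar> \<and>
       (\<forall>j. p j \<le> \<alpha> j + (if j \<in> {1..2*r+1} then \<tau> r else 0)))" for p Z
  have "\<exists>Z. good p Z" if p: "p \<in> P" for p
    unfolding good_def
  proof (rule separated_family[OF n N harm P(4)[OF p] r(2) s1])
    fix i assume i: "i \<in> {1..2*r+1}"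
    have "n * (a i div n) \<le> a i" by simp
    also have "a i \<le> p i + r * (a i div n)" using i r(2) by (intro P(6)[OF p]) auto
    finally have "(n - r) * (a i div n) \<le> p i" by (simp add: diff_mult_distrib)
    moreover have "1 * (a i div n) \<le> (n - r) * (a i div n)" using r(3) by (intro mult_le_mono1) auto
    ultimately show "\<tau> r \<le> p i" using \<tau>_le[OF i] by linarith
  qed
  then obtain Z where "\<And>p. p \<in> P \<Longrightarrow> good p (Z p)" by metis
  hence Z: "\<And>p. p \<in> P \<Longrightarrow> finite (Z p)" "\<And>p. p \<in> P \<Longrightarrow> separated (s (Suc r)) (Z p)"
    "\<And>p. p \<in> P \<Longrightarrow> Suc (\<tau> r) ^ Suc r \<le> (4 * spread n * s (Suc r)) ^ Suc r * card (Z p)"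
    "\<And>p \<alpha>. p \<in> P \<Longrightarrow> \<alpha> \<in> Z p \<Longrightarrow> \<alpha> \<in> simplex_lattice n N"
    "\<And>p \<alpha>. p \<in> P \<Longrightarrow> \<alpha> \<in> Z p \<Longrightarrow> \<bar>g p\<bar> \<le> loss n ^ Suc (\<tau> r) * \<bar>g \<alpha>\<bar>"
    "\<And>p \<alpha> j. p \<in> P \<Longrightarrow> \<alpha> \<in> Z p \<Longrightarrow> p j \<le> \<alpha> j + (if j \<in> {1..2*r+1} then \<tau> r else 0)"
    unfolding good_def by blast+
  have Z_low: "p j \<le> \<alpha> j + \<tau> r" if "p \<in> P" "\<alpha> \<in> Z p" for p \<alpha> j
    using Z(6)[OF that, of j] by (auto split: if_splits)
  have near: "\<alpha> j \<le> p j + n * \<tau> r" if "p \<in> P" "\<alpha> \<in> Z p" "j \<in> {1..n}" for p \<alpha> j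
    using Z_low[OF that(1,2)] that(3)
    by (intro simplex_le_of_lower_bounds[OF Z(4)[OF that(1,2)] P(4)[OF that(1)]]) auto
  have one_side: "\<alpha> j + s (Suc r) \<le> \<beta> j"
    if "p \<in> P" "p' \<in> P" "\<alpha> \<in> Z p" "\<beta> \<in> Z p'" "p j + s r \<le> p' j" for p p' \<alpha> \<beta> j
  proof -
    \<comment> \<open>A nonzero coordinate has its index in \<open>{1..n}\<close>, where
      \<open>near\<close> applies.\<close>
    have "p' j \<noteq> 0" using that(5) s1 s_rec by linarith
    hence j: "j \<in> {1..n}" using P(4)[OF that(2)] by (auto simp: simplex_lattice_def)
    have "\<tau> r \<le> n * \<tau> r" using n by simp
    thus ?thesis
      using near[OF that(1,3) j] Z_low[OF that(2,4), of j] that(5) s_rec by linarith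
  qed
  have ap: "apart (s (Suc r)) \<alpha> \<beta>"
    if pp: "p \<in> P" "p' \<in> P" "p \<noteq> p'" "\<alpha> \<in> Z p" "\<beta> \<in> Z p'" for p p' \<alpha> \<beta>
  proof -
    have "apart (s r) p p'" using P(2) pp(1-3) by (simp add: separated_def)
    thus ?thesis unfolding apart_def
      using one_side[OF pp(1,2,4,5)] one_side[OF pp(2,1,5,4)] by blast
  qed
  define Y where "Y = (\<Union>p\<in>P. Z p)"
  have "separated (s (Suc r)) Y" unfolding Y_def using Z(2) ap by (intro separated_UN) auto
  moreover have "finite Y" unfolding Y_def using P(1) Z(1) by blast
  moreover have "(\<Prod>j<Suc r. Suc (\<tau> j) ^ Suc j) \<le>
      (\<Prod>j<Suc r. (4 * spread n * s (Suc j)) ^ Suc j) * card Y"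
  proof -
    let ?F = "\<Prod>j<r. (4 * spread n * s (Suc j)) ^ Suc j"
    have "(\<Prod>j<Suc r. Suc (\<tau> j) ^ Suc j) \<le> (?F * card P) * Suc (\<tau> r) ^ Suc r"
      unfolding prod.lessThan_Suc using P(3) by (rule mult_le_mono1)
    also have "\<dots> = ?F * (\<Sum>p\<in>P. Suc (\<tau> r) ^ Suc r)" by simp
    also have "\<dots> \<le> ?F * (\<Sum>p\<in>P. (4 * spread n * s (Suc r)) ^ Suc r * card (Z p))"
      using Z(3) by (intro mult_le_mono2 sum_mono)
    also have "\<dots> = ?F * ((4 * spread n * s (Suc r)) ^ Suc r * card Y)"
      unfolding Y_def using card_UN_apart[OF P(1) s1 Z(1) ap] by (simp add: sum_distrib_left)
    finally show ?thesis by (simp only: prod.lessThan_Suc mult.assoc)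
  qed
  moreover have "\<forall>\<alpha>\<in>Y. \<alpha> \<in> simplex_lattice n N \<and>
      \<bar>g a\<bar> \<le> loss n ^ (\<Sum>j<Suc r. Suc (\<tau> j)) * \<bar>g \<alpha>\<bar> \<and>
      (\<forall>i\<in>{1..n}. a i \<le> \<alpha> i + Suc r * (a i div n))"
  proof
    fix \<alpha> assume "\<alpha> \<in> Y"
    then obtain p where p: "p \<in> P" "\<alpha> \<in> Z p" by (auto simp: Y_def)
    have L: "loss n \<ge> 1" using n by (intro loss_ge_1) auto
    have "\<bar>g a\<bar> \<le> loss n ^ (\<Sum>j<r. Suc (\<tau> j)) * (loss n ^ Suc (\<tau> r) * \<bar>g \<alpha>\<bar>)"
      using L by (intro order.trans[OF P(5)[OF p(1)]] mult_left_mono Z(5)[OF p]) auto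
    also have "\<dots> = loss n ^ (\<Sum>j<Suc r. Suc (\<tau> j)) * \<bar>g \<alpha>\<bar>"
      by (simp only: sum.lessThan_Suc power_add mult.assoc)
    finally have "\<bar>g a\<bar> \<le> loss n ^ (\<Sum>j<Suc r. Suc (\<tau> j)) * \<bar>g \<alpha>\<bar>" .
    moreover have "a i \<le> \<alpha> i + Suc r * (a i div n)" if i: "i \<in> {1..n}" for i
      using P(6)[OF p(1) i] Z(6)[OF p, of i] \<tau>_le[of i] by (auto split: if_splits)
    ultimately show "\<alpha> \<in> simplex_lattice n N \<and>
      \<bar>g a\<bar> \<le> loss n ^ (\<Sum>j<Suc r. Suc (\<tau> j)) * \<bar>g \<alpha>\<bar> \<and>
      (\<forall>i\<in>{1..n}. a i \<le> \<alpha> i + Suc r * (a i div n))" using Z(4)[OF p] by blast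
  qed
  ultimately show ?case by (intro exI[of _ Y]) blast
qed

text \<open>At each scale \<open>n\<close> pays for rounding in \<open>a (2 * j + 1) div n\<close>,
  and \<open>8 * n * n * spread n\<close> is \<open>4 * spread n\<close> times the constant
  \<open>2 * n * n\<close> that compares \<open>s j\<close> with
  \<open>Suc (\<tau> j)\<close>.\<close>

definition count_const :: "nat \<Rightarrow> nat" where
  "count_const n = (\<Prod>j\<le>(n - 1) div 2. n * (8 * n * n * spread n) ^ Suc j)"

text \<open>The counts of \<open>branching\<close> telescope: the separation
  \<open>s (Suc j)\<close> paid for in round \<open>j\<close> is at most a constant times
  \<open>Suc (\<tau> (Suc j))\<close>, so its power cancels all but one of the factors gained at the
  next scale.\<close>

lemma odd_coordinates_bound:
  fixes a :: "nat \<Rightarrow> nat"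
  assumes n: "n \<ge> 2" and N: "N \<ge> 1" and harm: "harmonic n N g" and a: "a \<in> simplex_lattice n N"
    and dec: "\<And>i. i \<in> {1..<n} \<Longrightarrow> a (i + 1) \<le> a i"
  shows "(\<Prod>j\<le>(n - 1) div 2. a (2 * j + 1) + 1) \<le>
    count_const n * card {\<alpha>\<in>simplex_lattice n N. \<bar>g a\<bar> \<le> loss n ^ (2 * n * N) * \<bar>g \<alpha>\<bar>}"
    (is "_ \<le> _ * card ?S")
proof -
  define q where "q = (n - 1) div 2"
  define \<tau> where "\<tau> j = a (2 * j + 1) div n" for j
  define s where "s r = 1 + 2 * n * (\<Sum>j=r..q. \<tau> j)" for r
  obtain P where P: "finite P"
    "(\<Prod>j<Suc q. Suc (\<tau> j) ^ Suc j) \<le> (\<Prod>j<Suc q. (4 * spread n * s (Suc j)) ^ Suc j) * card P"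
    "\<And>\<alpha>. \<alpha> \<in> P \<Longrightarrow> \<alpha> \<in> simplex_lattice n N"
    "\<And>\<alpha>. \<alpha> \<in> P \<Longrightarrow> \<bar>g a\<bar> \<le> loss n ^ (\<Sum>j<Suc q. Suc (\<tau> j)) * \<bar>g \<alpha>\<bar>"
    using branching[OF n N harm a dec, of "Suc ((n - 1) div 2)"] unfolding q_def \<tau>_def s_def by auto
  have q: "2 * q + 1 \<le> n" "q < n" using n by (auto simp: q_def)
  have L: "loss n \<ge> 1" using n by (intro loss_ge_1) auto
  have aN: "a i \<le> N" if "i \<in> {1..n}" for i
    using member_le_sum[of i "{1..n}" a] that simplex_sum[OF a] by auto
  have "(\<Sum>j<Suc q. Suc (\<tau> j)) \<le> (\<Sum>j<Suc q. 2 * N)"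
  proof (rule sum_mono)
    fix j assume "j \<in> {..<Suc q}"
    hence "a (2 * j + 1) \<le> N" using q by (intro aN) auto
    hence "\<tau> j \<le> N" unfolding \<tau>_def using div_le_dividend order.trans by blast
    thus "Suc (\<tau> j) \<le> 2 * N" using N by simp
  qed
  also have "\<dots> = Suc q * (2 * N)" by simp
  also have "\<dots> \<le> n * (2 * N)" using q by (intro mult_le_mono1) auto
  finally have expo: "(\<Sum>j<Suc q. Suc (\<tau> j)) \<le> 2 * n * N" by (simp only: mult_ac)
  have "P \<subseteq> ?S"
  proof
    fix \<alpha> assume \<alpha>: "\<alpha> \<in> P"
    have "loss n ^ (\<Sum>j<Suc q. Suc (\<tau> j)) * \<bar>g \<alpha>\<bar> \<le> loss n ^ (2 * n * N) * \<bar>g \<alpha>\<bar>"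
      using L expo by (intro mult_right_mono power_increasing) auto
    thus "\<alpha> \<in> ?S" using P(3,4)[OF \<alpha>] by auto
  qed
  hence cardP: "card P \<le> card ?S" using finite_simplex_lattice by (intro card_mono) auto
  have s_le: "s j \<le> 2 * n * n * Suc (\<tau> j)" for j
  proof -
    have "(\<Sum>i=j..q. \<tau> i) \<le> (\<Sum>i=j..q. \<tau> j)"
      unfolding \<tau>_def using q
      by (intro sum_mono div_le_mono antimono_from_steps[of n a, OF dec]) auto
    also have "\<dots> = (Suc q - j) * \<tau> j" by simp
    also have "\<dots> \<le> n * \<tau> j" using q by (intro mult_le_mono1) auto
    finally have "s j \<le> 1 + 2 * n * (n * \<tau> j)" unfolding s_def by simp
    also have "\<dots> \<le> 2 * n * n * Suc (\<tau> j)" using n by (simp add: algebra_simps Suc_le_eq)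
    finally show ?thesis .
  qed
  \<comment> \<open>After the last round the points only have to be distinct.\<close>
  have s_last: "s (Suc q) = 1" by (simp add: s_def)
  let ?K = "8 * n * n * spread n"
  \<comment> \<open>Of the \<open>Suc j\<close> factors at scale \<open>j\<close>, one is kept and
    \<open>j\<close> pay for the separation of the preceding round.\<close>
  have "(\<Prod>j<Suc q. Suc (\<tau> j)) * (\<Prod>j<q. Suc (\<tau> (Suc j)) ^ Suc j) = (\<Prod>j<Suc q. Suc (\<tau> j) ^ Suc j)"
  proof -
    have "(\<Prod>j<q. Suc (\<tau> (Suc j)) ^ Suc j) = (\<Prod>j<Suc q. Suc (\<tau> j) ^ j)"
      by (subst prod.lessThan_Suc_shift) simp
    thus ?thesis by (simp only: prod.distrib[symmetric] power_Suc)
  qed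
  also have "\<dots> \<le> (\<Prod>j<Suc q. (4 * spread n * s (Suc j)) ^ Suc j) * card P" by (rule P(2))
  also have "\<dots> \<le> ((\<Prod>j<Suc q. ?K ^ Suc j) * (\<Prod>j<q. Suc (\<tau> (Suc j)) ^ Suc j)) * card ?S"
  proof (rule mult_le_mono[OF _ cardP])
    have "(\<Prod>j<q. (4 * spread n * s (Suc j)) ^ Suc j) \<le> (\<Prod>j<q. (?K * Suc (\<tau> (Suc j))) ^ Suc j)"
    proof (rule prod_mono, rule conjI, simp, rule power_mono)
      fix j
      have "4 * spread n * s (Suc j) \<le> 4 * spread n * (2 * n * n * Suc (\<tau> (Suc j)))"
        by (intro mult_le_mono2 s_le)
      thus "4 * spread n * s (Suc j) \<le> ?K * Suc (\<tau> (Suc j))" by (simp add: algebra_simps)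
    qed simp
    moreover have "(4 * spread n * s (Suc q)) ^ Suc q \<le> ?K ^ Suc q"
      unfolding s_last using n by (intro power_mono) auto
    ultimately have "(\<Prod>j<Suc q. (4 * spread n * s (Suc j)) ^ Suc j) \<le>
        (\<Prod>j<q. (?K * Suc (\<tau> (Suc j))) ^ Suc j) * ?K ^ Suc q"
      unfolding prod.lessThan_Suc by (rule mult_le_mono)
    also have "\<dots> = (\<Prod>j<Suc q. ?K ^ Suc j) * (\<Prod>j<q. Suc (\<tau> (Suc j)) ^ Suc j)"
      unfolding prod.lessThan_Suc power_mult_distrib prod.distrib by (simp only: mult_ac)
    finally show "(\<Prod>j<Suc q. (4 * spread n * s (Suc j)) ^ Suc j) \<le>
        (\<Prod>j<Suc q. ?K ^ Suc j) * (\<Prod>j<q. Suc (\<tau> (Suc j)) ^ Suc j)" .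
  qed
  also have "\<dots> = ((\<Prod>j<Suc q. ?K ^ Suc j) * card ?S) * (\<Prod>j<q. Suc (\<tau> (Suc j)) ^ Suc j)"
    by (simp only: mult_ac)
  finally have le: "(\<Prod>j<Suc q. Suc (\<tau> j)) * (\<Prod>j<q. Suc (\<tau> (Suc j)) ^ Suc j) \<le>
      ((\<Prod>j<Suc q. ?K ^ Suc j) * card ?S) * (\<Prod>j<q. Suc (\<tau> (Suc j)) ^ Suc j)" .
  have pos: "(\<Prod>j<q. Suc (\<tau> (Suc j)) ^ Suc j) > 0" by (simp add: prod_pos)
  have \<tau>_prod: "(\<Prod>j<Suc q. Suc (\<tau> j)) \<le> (\<Prod>j<Suc q. ?K ^ Suc j) * card ?S"
    by (rule mult_le_cancel2[THEN iffD1, THEN mp, OF le pos])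
  have "(\<Prod>j<Suc q. a (2 * j + 1) + 1) \<le> (\<Prod>j<Suc q. n * Suc (\<tau> j))"
  proof (rule prod_mono, rule conjI, simp)
    fix j
    have "a (2 * j + 1) < n + n * \<tau> j"
      unfolding \<tau>_def by (rule dividend_less_times_div) (use n in simp)
    thus "a (2 * j + 1) + 1 \<le> n * Suc (\<tau> j)" by simp
  qed
  also have "\<dots> = (\<Prod>j<Suc q. n) * (\<Prod>j<Suc q. Suc (\<tau> j))" by (rule prod.distrib)
  also have "\<dots> \<le> (\<Prod>j<Suc q. n) * ((\<Prod>j<Suc q. ?K ^ Suc j) * card ?S)"
    using \<tau>_prod by (rule mult_le_mono2)
  also have "\<dots> = count_const n * card ?S"
    by (simp only: count_const_def q_def[symmetric] lessThan_Suc_atMost prod.distrib mult.assoc)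
  finally show ?thesis by (simp only: q_def lessThan_Suc_atMost)
qed

section \<open>Comparison of the odd-indexed product with \<open>Phi\<close>\<close>

lemma prod_le_odd_prod:
  fixes A :: "nat \<Rightarrow> real"
  assumes "\<And>i. i \<in> {1..2*r+1} \<Longrightarrow> 1 \<le> A i" "\<And>i. i \<in> {1..2*r+1} \<Longrightarrow> A i \<le> M"
  shows "(\<Prod>i=1..2*r+1. A i) \<le> M ^ r * (\<Prod>j\<le>r. A (2 * j + 1))"
  using assms
proof (induction r)
  case (Suc r)
  have IH: "(\<Prod>i=1..2*r+1. A i) \<le> M ^ r * (\<Prod>j\<le>r. A (2 * j + 1))"
    by (rule Suc.IH) (use Suc.prems in auto)
  have A: "1 \<le> A (2 * r + 2)" "A (2 * r + 2) \<le> M" "1 \<le> A (2 * r + 3)"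
    using Suc.prems by auto
  have "(\<Prod>i=1..2 * Suc r + 1. A i) = (\<Prod>i=1..2*r+1. A i) * (A (2 * r + 2) * A (2 * r + 3))"
    by (simp add: numeral_3_eq_3 mult_ac)
  also have "\<dots> \<le> (M ^ r * (\<Prod>j\<le>r. A (2 * j + 1))) * (M * A (2 * r + 3))"
  proof (rule mult_mono[OF IH])
    have "0 \<le> (\<Prod>i=1..2*r+1. A i)" by (rule prod_nonneg) (use Suc.prems in force)
    thus "0 \<le> M ^ r * (\<Prod>j\<le>r. A (2 * j + 1))" using IH by linarith
  qed (use A in auto)
  also have "\<dots> = M ^ Suc r * (\<Prod>j\<le>Suc r. A (2 * j + 1))"
    by (simp add: numeral_3_eq_3 mult_ac)
  finally show ?case .
qed simp

text \<open>For \<open>n = 2 * r + 3\<close> the \<open>r\<close> factors of even index, each at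
  most \<open>N + 1\<close>, cancel the denominator. For \<open>n = 2 * r + 4\<close> there are
  \<open>r + 1\<close> such factors among the first \<open>n - 2\<close>, again matching the
  exponent, and the factor of \<open>a n\<close> is replaced by the larger one of the odd index
  \<open>n - 1\<close>, which \<open>Phi\<close> omits.\<close>

lemma Phi_le_odd_prod:
  fixes a :: "nat \<Rightarrow> nat"
  assumes n: "n \<ge> 3" and a: "a \<in> simplex_lattice n N"
    and dec: "\<And>i. i \<in> {1..<n} \<Longrightarrow> a (i + 1) \<le> a i"
  shows "Phi n N a \<le> real (\<Prod>j\<le>(n - 1) div 2. a (2 * j + 1) + 1)"
proof -
  define A where "A i = real (a i) + 1" for i
  define M where "M = real N + 1"
  obtain r where r: "(n - 1) div 2 = Suc r" using n by (cases "(n - 1) div 2") auto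
  have AM: "1 \<le> A i" "A i \<le> M" if "i \<in> {1..n}" for i
    using member_le_sum[of i "{1..n}" a] that simplex_sum[OF a] by (auto simp: A_def M_def)
  have M1: "M \<ge> 1" by (simp add: M_def)
  let ?O = "\<Prod>j\<le>r. A (2 * j + 1)"
  have O: "(\<Prod>i=1..2*r+1. A i) \<le> M ^ r * ?O"
    by (rule prod_le_odd_prod) (use AM r in auto)
  have O0: "?O \<ge> 0" by (intro prod_nonneg) (simp add: A_def)
  have A0: "A i \<ge> 0" for i by (simp add: A_def)
  have goal: "real (\<Prod>j\<le>(n - 1) div 2. a (2 * j + 1) + 1) = ?O * A (2 * r + 3)"
    unfolding r by (simp add: A_def numeral_3_eq_3 algebra_simps)
  consider "n = 2 * r + 3" | "n = 2 * r + 4" using r by linarith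
  thus ?thesis
  proof cases
    case 1
    have "A n * (\<Prod>i=1..n-2. A i) \<le> A n * (M ^ r * ?O)"
      using O A0 1 by (intro mult_left_mono) auto
    hence "A n * (\<Prod>i=1..n-2. A i) / M ^ r \<le> ?O * A (2 * r + 3)"
      using M1 1 by (simp add: field_simps)
    moreover have "(n - 2) div 2 = r" using 1 by simp
    ultimately show ?thesis unfolding goal by (simp add: Phi_def A_def M_def)
  next
    case 2
    have A_last: "A (2 * r + 4) \<le> A (2 * r + 3)"
      using dec[of "2 * r + 3"] 2 by (simp add: A_def numeral_eq_Suc)
    have "(\<Prod>i=1..n-2. A i) = (\<Prod>i=1..2*r+1. A i) * A (2 * r + 2)" using 2 by simp
    also have "\<dots> \<le> (M ^ r * ?O) * M"
      using O O0 A0 M1 AM(2)[of "2 * r + 2"] 2 by (intro mult_mono) auto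
    finally have "A n * (\<Prod>i=1..n-2. A i) \<le> A (2 * r + 3) * ((M ^ r * ?O) * M)"
      unfolding 2 using A_last A0 by (intro mult_mono prod_nonneg) auto
    hence "A n * (\<Prod>i=1..n-2. A i) / M ^ Suc r \<le> ?O * A (2 * r + 3)"
      using M1 by (simp add: field_simps)
    moreover have "(n - 2) div 2 = Suc r" using 2 by simp
    ultimately show ?thesis unfolding goal by (simp add: Phi_def A_def M_def)
  qed
qed

theorem theorem2p3:
  fixes n :: nat
  assumes "n \<ge> 3"
  shows "\<exists>c C :: real. c > 0 \<and> C > 0 \<and>
    (\<forall>(N :: nat) (a :: nat \<Rightarrow> nat) (g :: (nat \<Rightarrow> nat) \<Rightarrow> real).
       N \<ge> 1 \<longrightarrow>
       a \<in> simplex_lattice n N \<longrightarrow>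
       (\<forall>i\<in>{1..<n}. a i \<ge> a (i + 1)) \<longrightarrow>
       g a \<noteq> 0 \<longrightarrow>
       (\<forall>\<beta> \<in> simplex_lattice n (N - 1). (\<Sum>i=1..n. g (\<lambda>j. \<beta> j + coord_vec i j)) = 0) \<longrightarrow>
       real (card {\<alpha> \<in> simplex_lattice n N. \<bar>g \<alpha>\<bar> \<ge> exp (- C * real N) * \<bar>g a\<bar>})
         \<ge> c * Phi n N a)"
proof -
  have n: "n \<ge> 2" using assms by simp
  have L: "loss n \<ge> 1" using n by (intro loss_ge_1) auto
  define K where "K = count_const n"
  have K: "K > 0" unfolding K_def count_const_def spread_def using n by (intro prod_pos) auto
  \<comment> \<open>Turns \<open>loss n ^ (2 * n * N)\<close> into an exponential; the summand 1
    yields \<open>C > 0\<close> from \<open>loss n \<ge> 1\<close> alone.\<close>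
  define C where "C = real (2 * n) * ln (loss n) + 1"
  have "C > 0" using L by (simp add: C_def add_nonneg_pos)
  moreover have "1 / real K > 0" using K by simp
  moreover have "real (card {\<alpha> \<in> simplex_lattice n N. \<bar>g \<alpha>\<bar> \<ge> exp (- C * real N) * \<bar>g a\<bar>})
         \<ge> 1 / real K * Phi n N a"
    if N: "N \<ge> 1" and a: "a \<in> simplex_lattice n N" and dec: "\<forall>i\<in>{1..<n}. a i \<ge> a (i + 1)"
      and g: "\<forall>\<beta> \<in> simplex_lattice n (N - 1). (\<Sum>i=1..n. g (\<lambda>j. \<beta> j + coord_vec i j)) = 0"
    for N a and g :: "(nat \<Rightarrow> nat) \<Rightarrow> real"
  proof -
    let ?S = "{\<alpha>\<in>simplex_lattice n N. \<bar>g a\<bar> \<le> loss n ^ (2 * n * N) * \<bar>g \<alpha>\<bar>}"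
    have dec': "\<And>i. i \<in> {1..<n} \<Longrightarrow> a (i + 1) \<le> a i" using dec by blast
    have "loss n ^ (2 * n * N) = exp (real (2 * n * N) * ln (loss n))"
      using L by (subst exp_of_nat_mult) simp
    also have "\<dots> \<le> exp (C * real N)" by (simp add: C_def algebra_simps)
    finally have e: "loss n ^ (2 * n * N) \<le> exp (C * real N)" .
    have "?S \<subseteq> {\<alpha> \<in> simplex_lattice n N. \<bar>g \<alpha>\<bar> \<ge> exp (- C * real N) * \<bar>g a\<bar>}"
    proof
      fix \<alpha> assume \<alpha>: "\<alpha> \<in> ?S"
      hence "\<bar>g a\<bar> \<le> exp (C * real N) * \<bar>g \<alpha>\<bar>"
        using mult_right_mono[OF e, of "\<bar>g \<alpha>\<bar>"] by simp
      hence "exp (- C * real N) * \<bar>g a\<bar> \<le> exp (- C * real N) * (exp (C * real N) * \<bar>g \<alpha>\<bar>)"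
        by (intro mult_left_mono) auto
      also have "\<dots> = \<bar>g \<alpha>\<bar>" by (simp flip: mult.assoc exp_add)
      finally show "\<alpha> \<in> {\<alpha> \<in> simplex_lattice n N. \<bar>g \<alpha>\<bar> \<ge> exp (- C * real N) * \<bar>g a\<bar>}"
        using \<alpha> by simp
    qed
    hence card: "card ?S \<le> card {\<alpha> \<in> simplex_lattice n N. \<bar>g \<alpha>\<bar> \<ge> exp (- C * real N) * \<bar>g a\<bar>}"
      using finite_simplex_lattice by (intro card_mono) auto
    have "Phi n N a \<le> real (\<Prod>j\<le>(n - 1) div 2. a (2 * j + 1) + 1)"
      by (rule Phi_le_odd_prod[OF assms a dec'])
    also have "\<dots> \<le> real (K * card ?S)"
      unfolding of_nat_le_iff K_def
      by (rule odd_coordinates_bound[OF n N _ a dec']) (unfold harmonic_def, rule g)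
    finally have "1 / real K * Phi n N a \<le> real (card ?S)"
      using K by (simp add: field_simps)
    thus ?thesis using card by linarith
  qed
  ultimately show ?thesis by (intro exI[of _ "1 / real K"] exI[of _ C]) blast
qed

end
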